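(* Let $\mathscr{A}$ be a $C^*$-algebra and let $\mathscr{X}$, $\mathscr{Z}$ be Hilbert $\mathscr{A}$-modules. Let $B:\mathscr{X}\times\mathscr{Z}\to\mathscr{A}$ be a bounded $\mathscr{A}$-sesquilinear form. Then $B$ extends uniquely to a bounded $\mathscr{A}$-sesquilinear form on $\mathscr{X}''\times\mathscr{Z}''$; that is, there is a unique bounded $\mathscr{A}$-sesquilinear form $\widetilde B:\mathscr{X}''\times\mathscr{Z}''\to\mathscr{A}$ with $\widetilde B(\dot x,\dot z)=B(x,z)$ for all $x\in\mathscr{X}$, $z\in\mathscr{Z}$.
   Context: Hilbert $C^*$-modules are right modules with inner product conjugate-linear in the first and $\mathscr{A}$-linear in the second variable. A bounded $\mathscr{A}$-sesquilinear form is a bounded map that is anti-$\mathscr{A}$-linear in the first and $\mathscr{A}$-linear in the second variable ($B(xa,zb)=a^*B(x,z)b$). $\mathscr{X}'$ is the set of bounded $\mathscr{A}$-linear maps $\mathscr{X}\to\mathscr{A}$, a right $\mathscr{A}$-module via $(\rho+\lambda\tau)(x)=\rho(x)+\overline{\lambda}\tau(x)$, $(\tau b)(x)=b^*\tau(x)$; $\mathscr{X}''=(\mathscr{X}')'$. For $x\in\mathscr{X}$, $\widehat x\in\mathscr{X}'$ is $\widehat x(y)=\langle x,y\rangle$ and $\dot x\in\mathscr{X}''$ is $\dot x(f)=f(x)^*$ ($f\in\mathscr{X}'$). $\mathscr{X}''$ carries the $\mathscr{A}$-valued inner product $\langle F,G\rangle=F(\dot G)$ with $\dot G(x)=G(\widehat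 x)$, and $\mathscr{X}$ is identified with a submodule of $\mathscr{X}''$ via $x\mapsto\dot x$. The same notation is used for $\mathscr{Z}$. *)

theory Defs
  imports "HOL-Analysis.Abstract_Metric_Spaces" "HOL-Algebra.Group"
begin

text \<open>
  Complex C*-algebras, not assumed unital. The inherited class provides the real structure, a
  complete submultiplicative norm and a (possibly trivial) ring.
\<close>

class cstar_algebra = real_normed_algebra + banach +
  fixes scaleC :: "complex \<Rightarrow> 'a \<Rightarrow> 'a"
    and star :: "'a \<Rightarrow> 'a"
  assumes scaleC_add_right: "scaleC c (a + b) = scaleC c a + scaleC c b"
    and scaleC_add_left: "scaleC (c + d) a = scaleC c a + scaleC d a"
    and scaleC_scaleC: "scaleC c (scaleC d a) = scaleC (c * d) a"
    and scaleC_of_real: "scaleC (complex_of_real r) a = r *\<^sub>R a"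
    and mult_scaleC_left: "scaleC c a * b = scaleC c (a * b)"
    and mult_scaleC_right: "a * scaleC c b = scaleC c (a * b)"
    and norm_scaleC: "norm (scaleC c a) = cmod c * norm a"
    and star_add: "star (a + b) = star a + star b"
    and star_scaleC: "star (scaleC c a) = scaleC (cnj c) (star a)"
    and star_mult: "star (a * b) = star b * star a"
    and star_star: "star (star a) = a"
    and norm_star_mult: "norm (star a * a) = (norm a)\<^sup>2"

definition cstar_positive :: "'a::cstar_algebra \<Rightarrow> bool"
  where "cstar_positive a \<longleftrightarrow> (\<exists>b. a = star b * b)"

text \<open>Right modules over a C*-algebra, with a compatible complex vector space structure.\<close>

record ('a, 'x) amodule = "'x partial_object" +
  mzero :: 'x (\<open>\<zero>\<index>\<close>)
  madd :: "'x \<Rightarrow> 'x \<Rightarrow> 'x" (infixl \<open>\<oplus>\<index>\<close> 65)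
  mscale :: "complex \<Rightarrow> 'x \<Rightarrow> 'x" (infixr \<open>\<cdot>\<index>\<close> 75)
  mact :: "'x \<Rightarrow> 'a \<Rightarrow> 'x" (infixl \<open>\<triangleleft>\<index>\<close> 75)

record ('a, 'x) ip_module = "('a, 'x) amodule" +
  ip :: "'x \<Rightarrow> 'x \<Rightarrow> 'a" (\<open>\<langle>_,/ _\<rangle>\<index>\<close>)

definition hnorm :: "('a::cstar_algebra, 'x) ip_module \<Rightarrow> 'x \<Rightarrow> real"
  where "hnorm X x = sqrt (norm (ip X x x))"

locale amodule =
  fixes X :: "('a::cstar_algebra, 'x, 'm) amodule_scheme" (structure)
  assumes add_group: "comm_group \<lparr>carrier = carrier X, monoid.mult = madd X, monoid.one = mzero X\<rparr>"
    and scale_closed: "x \<in> carrier X \<Longrightarrow> c \<cdot> x \<in> carrier X"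
    and scale_add_right:
      "\<lbrakk>x \<in> carrier X; y \<in> carrier X\<rbrakk> \<Longrightarrow> c \<cdot> (x \<oplus> y) = c \<cdot> x \<oplus> c \<cdot> y"
    and scale_add_left: "x \<in> carrier X \<Longrightarrow> (c + d) \<cdot> x = c \<cdot> x \<oplus> d \<cdot> x"
    and scale_scale: "x \<in> carrier X \<Longrightarrow> c \<cdot> d \<cdot> x = (c * d) \<cdot> x"
    and scale_one: "x \<in> carrier X \<Longrightarrow> 1 \<cdot> x = x"
    and act_closed: "x \<in> carrier X \<Longrightarrow> x \<triangleleft> a \<in> carrier X"
    and act_add_left:
      "\<lbrakk>x \<in> carrier X; y \<in> carrier X\<rbrakk> \<Longrightarrow> (x \<oplus> y) \<triangleleft> a = x \<triangleleft> a \<oplus> y \<triangleleft> a"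
    and act_add_right: "x \<in> carrier X \<Longrightarrow> x \<triangleleft> (a + b) = x \<triangleleft> a \<oplus> x \<triangleleft> b"
    and act_act: "x \<in> carrier X \<Longrightarrow> (x \<triangleleft> a) \<triangleleft> b = x \<triangleleft> (a * b)"
    and scale_act: "x \<in> carrier X \<Longrightarrow> (c \<cdot> x) \<triangleleft> a = c \<cdot> (x \<triangleleft> a)"
    and act_scaleC: "x \<in> carrier X \<Longrightarrow> x \<triangleleft> scaleC c a = c \<cdot> (x \<triangleleft> a)"

locale hilbert_module = amodule X
  for X :: "('a::cstar_algebra, 'x) ip_module" (structure) +
  assumes ip_add_right:
      "\<lbrakk>x \<in> carrier X; y \<in> carrier X; z \<in> carrier X\<rbrakk> \<Longrightarrow> \<langle>x, y \<oplus> z\<rangle> = \<langle>x, y\<rangle> + \<langle>x, z\<rangle>"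
    and ip_scale_right:
      "\<lbrakk>x \<in> carrier X; y \<in> carrier X\<rbrakk> \<Longrightarrow> \<langle>x, c \<cdot> y\<rangle> = scaleC c \<langle>x, y\<rangle>"
    and ip_act_right:
      "\<lbrakk>x \<in> carrier X; y \<in> carrier X\<rbrakk> \<Longrightarrow> \<langle>x, y \<triangleleft> a\<rangle> = \<langle>x, y\<rangle> * a"
    and ip_star: "\<lbrakk>x \<in> carrier X; y \<in> carrier X\<rbrakk> \<Longrightarrow> star \<langle>x, y\<rangle> = \<langle>y, x\<rangle>"
    and ip_positive: "x \<in> carrier X \<Longrightarrow> cstar_positive \<langle>x, x\<rangle>"
    and ip_definite: "\<lbrakk>x \<in> carrier X; \<langle>x, x\<rangle> = 0\<rbrakk> \<Longrightarrow> x = \<zero>"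
    and complete: "Metric_space.mcomplete (carrier X) (\<lambda>x y. hnorm X (x \<oplus> (-1) \<cdot> y))"

definition module_map :: "('a::cstar_algebra, 'x, 'm) amodule_scheme \<Rightarrow> ('x \<Rightarrow> 'a) \<Rightarrow> bool"
  where "module_map X f \<longleftrightarrow>
    (\<forall>x\<in>carrier X. \<forall>y\<in>carrier X. f (x \<oplus>\<^bsub>X\<^esub> y) = f x + f y) \<and>
    (\<forall>x\<in>carrier X. \<forall>c. f (c \<cdot>\<^bsub>X\<^esub> x) = scaleC c (f x)) \<and>
    (\<forall>x\<in>carrier X. \<forall>a. f (x \<triangleleft>\<^bsub>X\<^esub> a) = f x * a)"

text \<open>
  The dual of a module \<open>X\<close> with respect to a norm \<open>N\<close> on it. Maps with domain \<open>carrier X\<close> are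
  represented by extensional functions, so that equal maps are equal in HOL. The module operations
  are the conjugated ones, which make the dual again a right module.
\<close>

definition dual ::
    "('a::cstar_algebra, 'x, 'm) amodule_scheme \<Rightarrow> ('x \<Rightarrow> real) \<Rightarrow> ('a, 'x \<Rightarrow> 'a) amodule"
  where "dual X N =
    \<lparr>carrier = {f \<in> extensional (carrier X).
        module_map X f \<and> (\<exists>K. \<forall>x\<in>carrier X. norm (f x) \<le> K * N x)},
     mzero = (\<lambda>x\<in>carrier X. 0),
     madd = (\<lambda>f g. \<lambda>x\<in>carrier X. f x + g x),
     mscale = (\<lambda>c f. \<lambda>x\<in>carrier X. scaleC (cnj c) (f x)),
     mact = (\<lambda>f b. \<lambda>x\<in>carrier X. star b * f x)\<rparr>"

definition dual_norm ::
    "('a::cstar_algebra, 'x, 'm) amodule_scheme \<Rightarrow> ('x \<Rightarrow> real) \<Rightarrow> ('x \<Rightarrow> 'a) \<Rightarrow> real"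
  where "dual_norm X N f = (SUP x\<in>{x \<in> carrier X. N x \<le> 1}. norm (f x))"

abbreviation hdual :: "('a::cstar_algebra, 'x) ip_module \<Rightarrow> ('a, 'x \<Rightarrow> 'a) amodule"
  where "hdual X \<equiv> dual X (hnorm X)"

abbreviation hdual_norm :: "('a::cstar_algebra, 'x) ip_module \<Rightarrow> ('x \<Rightarrow> 'a) \<Rightarrow> real"
  where "hdual_norm X \<equiv> dual_norm X (hnorm X)"

definition hat :: "('a::cstar_algebra, 'x) ip_module \<Rightarrow> 'x \<Rightarrow> 'x \<Rightarrow> 'a"
  where "hat X x = (\<lambda>y\<in>carrier X. \<langle>x, y\<rangle>\<^bsub>X\<^esub>)"

definition bidot :: "('a::cstar_algebra, 'x) ip_module \<Rightarrow> 'x \<Rightarrow> ('x \<Rightarrow> 'a) \<Rightarrow> 'a"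
  where "bidot X x = (\<lambda>f\<in>carrier (hdual X). star (f x))"

text \<open>The restriction of an element of the bidual along the embedding \<open>hat X\<close>.\<close>

definition codot :: "('a::cstar_algebra, 'x) ip_module \<Rightarrow> (('x \<Rightarrow> 'a) \<Rightarrow> 'a) \<Rightarrow> 'x \<Rightarrow> 'a"
  where "codot X G = (\<lambda>x\<in>carrier X. G (hat X x))"

text \<open>
  The bidual is the dual of the dual, the latter normed by the operator norm. As for every
  inner product module, the norm on the bidual itself is \<^const>\<open>hnorm\<close>, induced by its
  inner product.
\<close>

definition bidual :: "('a::cstar_algebra, 'x) ip_module \<Rightarrow> ('a, ('x \<Rightarrow> 'a) \<Rightarrow> 'a) ip_module"
  where "bidual X =
    amodule.extend (dual (hdual X) (hdual_norm X))
      (ip_module.fields (\<lambda>F G. F (codot X G)))"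

definition bounded_sesquilinear_form ::
    "('a::cstar_algebra, 'x) ip_module \<Rightarrow> ('a, 'z) ip_module \<Rightarrow> ('x \<times> 'z \<Rightarrow> 'a) \<Rightarrow> bool"
  where "bounded_sesquilinear_form X Z B \<longleftrightarrow>
    B \<in> extensional (carrier X \<times> carrier Z) \<and>
    (\<forall>x\<in>carrier X. \<forall>y\<in>carrier X. \<forall>z\<in>carrier Z. B (x \<oplus>\<^bsub>X\<^esub> y, z) = B (x, z) + B (y, z)) \<and>
    (\<forall>x\<in>carrier X. \<forall>z\<in>carrier Z. \<forall>c. B (c \<cdot>\<^bsub>X\<^esub> x, z) = scaleC (cnj c) (B (x, z))) \<and>
    (\<forall>x\<in>carrier X. \<forall>z\<in>carrier Z. \<forall>a. B (x \<triangleleft>\<^bsub>X\<^esub> a, z) = star a * B (x, z)) \<and>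
    (\<forall>x\<in>carrier X. \<forall>y\<in>carrier Z. \<forall>z\<in>carrier Z. B (x, y \<oplus>\<^bsub>Z\<^esub> z) = B (x, y) + B (x, z)) \<and>
    (\<forall>x\<in>carrier X. \<forall>z\<in>carrier Z. \<forall>c. B (x, c \<cdot>\<^bsub>Z\<^esub> z) = scaleC c (B (x, z))) \<and>
    (\<forall>x\<in>carrier X. \<forall>z\<in>carrier Z. \<forall>b. B (x, z \<triangleleft>\<^bsub>Z\<^esub> b) = B (x, z) * b) \<and>
    (\<exists>K. \<forall>x\<in>carrier X. \<forall>z\<in>carrier Z. norm (B (x, z)) \<le> K * hnorm X x * hnorm Z z)"

end

(*
  Define the extension by F (x |-> G (B (x, .))). Its boundedness and its uniqueness both rest on
  the fact that an A-linear functional on X' (or on X'') is controlled by its restriction to X.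
  X need not be norm dense in X', but it is dense locally: for f in the unit ball of X' and
  Q = f(x) f(x)^*, the distance from f Q to x f(x)^* Q is at most 2/5, because
  f f^* <= 1 in the row sense forces (f - f(x)<x,.>)(f - f(x)<x,.>)^* <= 1 - Q, and
  Q (1 - Q) Q <= 4/27 < (2/5)^2. A functional of norm M that is nearly attained at y is nearly
  attained on such a localisation of y, so M <= phi + 2M/5, where phi is the norm of the restriction
  to X. The same approximation compares the inner product norm of the bidual with the operator norm.
*)
theory Submission
  imports Defs "HOL-Analysis.Bounded_Linear_Function"
begin

text \<open>Localisation works because functionals are A-linear:
  \<open>\<psi> (f Q) = \<psi> f * Q\<close>, so an approximation of f Q still says something about
  \<open>\<psi> f\<close>. The weight Q is needed because the defect is only bounded by 1 - Q, which
  need not be small. Besides staying below 1 for the absorption M <= phi + 2M/5, the constant 2/5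
  has to stay below 1/2: when the inner product norm on the bidual is bounded from below, the error
  is 2/5 times 5/3 = 1/(1 - 2/5), and this 2/3 has to be less than 1. The estimates add and drop
  positive elements of A, and positivity is given only as \<open>star b * b\<close>. That such
  elements generate a closed cone on which the norm is monotone has to come out of the C*-identity.
  As A may lack a unit, 1 - Q and its roots are operators on A; a root applied to an element of A is
  again in A, which brings the result back.\<close>

lemma scaleC_diff_right: "scaleC c (a - b) = scaleC c a - scaleC c (b::'a::cstar_algebra)"
  by (metis add_diff_cancel_right' diff_add_cancel scaleC_add_right)

lemma scaleC_minus_one: "scaleC (-1) a = - (a::'a::cstar_algebra)"
  using scaleC_of_real[of "-1" a] by simp

lemma star_zero [simp]: "star (0::'a::cstar_algebra) = 0"
  by (metis add_cancel_right_left star_add)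

lemma star_minus: "star (- a) = - star (a::'a::cstar_algebra)"
  by (metis add.right_inverse add_eq_0_iff star_add star_zero)

lemma star_diff: "star (a - b) = star a - star (b::'a::cstar_algebra)"
  by (metis add_uminus_conv_diff star_add star_minus)

lemma star_scaleR: "star (r *\<^sub>R a) = r *\<^sub>R star (a::'a::cstar_algebra)"
  by (metis complex_cnj_complex_of_real scaleC_of_real star_scaleC)

lemma norm_star [simp]: "norm (star a) = norm (a::'a::cstar_algebra)"
proof -
  have *: "norm b \<le> norm (star b)" for b :: 'a
  proof (cases "b = 0")
    case False
    have "norm b * norm b \<le> norm (star b) * norm b"
      using norm_mult_ineq[of "star b" b] by (simp add: norm_star_mult power2_eq_square)
    with False show ?thesis by simp
  qed simp
  show ?thesis using *[of a] *[of "star a"] by (simp add: star_star)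
qed

lemma norm_mult_star: "norm (a * star a) = (norm (a::'a::cstar_algebra))\<^sup>2"
  using norm_star_mult[of "star a"] by (simp add: star_star)

lemma bounded_linear_star: "bounded_linear (star :: 'a::cstar_algebra \<Rightarrow> 'a)"
  by (rule bounded_linear_intro[where K=1]) (auto simp: star_add star_scaleR)

text \<open>Nondegeneracy of the form \<open>star x * y\<close>, seen at \<open>x = a\<close> by the
  C*-identity; it stands in for testing against a unit.\<close>

lemma star_mult_eq_0_imp: "(\<And>x. star x * a = 0) \<Longrightarrow> a = (0::'a::cstar_algebra)"
  by (metis norm_eq_zero norm_star_mult power_eq_0_iff)

text \<open>The C*-identity used twice reaches the fourth power; splitting off one factor leaves the
  cube, whose norm is thereby bounded from below.\<close>

lemma norm_self_adjoint_power4: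
  fixes a :: "'a::cstar_algebra"
  assumes "star a = a"
  shows "norm a ^ 4 \<le> norm (a * a * a) * norm a"
proof -
  have "norm a ^ 4 = norm ((a * a) * (a * a))"
    using norm_star_mult[of a] norm_star_mult[of "a * a"] assms by (simp add: star_mult)
  also have "\<dots> = norm ((a * a * a) * a)" by (simp add: mult.assoc)
  also have "\<dots> \<le> norm (a * a * a) * norm a" by (rule norm_mult_ineq)
  finally show ?thesis .
qed

section \<open>Self-adjoint operators\<close>

text \<open>
  A is not assumed unital, so the functional calculus lives in the algebra of bounded operators
  on A, in which A acts by left multiplication; only operators that are self-adjoint for the
  A-valued form \<open>star x * y\<close> matter.
\<close>

definition self_adjoint :: "('a::cstar_algebra \<Rightarrow>\<^sub>L 'a) \<Rightarrow> bool"
  where "self_adjoint T \<longleftrightarrow> (\<forall>x y. star (T x) * y = star x * T y)"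

abbreviation scalar_op :: "real \<Rightarrow> 'a::real_normed_vector \<Rightarrow>\<^sub>L 'a"
  where "scalar_op r \<equiv> r *\<^sub>R id_blinfun"

abbreviation lmult :: "'a::real_normed_algebra \<Rightarrow> 'a \<Rightarrow>\<^sub>L 'a"
  where "lmult \<equiv> blinfun_mult_right"

lemma self_adjoint_scalar_op: "self_adjoint (scalar_op r)"
  by (simp add: self_adjoint_def blinfun.bilinear_simps star_scaleR)

lemma self_adjoint_lmult: "star a = a \<Longrightarrow> self_adjoint (lmult a)"
  by (simp add: self_adjoint_def star_mult mult.assoc)

lemma self_adjoint_add: "self_adjoint S \<Longrightarrow> self_adjoint T \<Longrightarrow> self_adjoint (S + T)"
  by (simp add: self_adjoint_def blinfun.bilinear_simps star_add algebra_simps)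

lemma self_adjoint_diff: "self_adjoint S \<Longrightarrow> self_adjoint T \<Longrightarrow> self_adjoint (S - T)"
  by (simp add: self_adjoint_def blinfun.bilinear_simps star_diff algebra_simps)

lemma self_adjoint_scaleR: "self_adjoint T \<Longrightarrow> self_adjoint (r *\<^sub>R T)"
  by (simp add: self_adjoint_def blinfun.bilinear_simps star_scaleR)

lemma self_adjoint_compose:
  "\<lbrakk>self_adjoint S; self_adjoint T; S o\<^sub>L T = T o\<^sub>L S\<rbrakk> \<Longrightarrow> self_adjoint (S o\<^sub>L T)"
  by (metis self_adjoint_def blinfun_apply_blinfun_compose)

text \<open>The type of \<open>T\<close> only records real linearity; complex linearity comes from
  moving \<open>T\<close> to the other side of the nondegenerate form.\<close>

lemma self_adjoint_scaleC:
  assumes "self_adjoint T"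
  shows "T (scaleC c x) = scaleC c (T x)"
proof -
  have "star y * (T (scaleC c x) - scaleC c (T x)) = 0" for y
    using assms unfolding self_adjoint_def
    by (metis right_diff_distrib mult_scaleC_right diff_self)
  then show ?thesis using star_mult_eq_0_imp by fastforce
qed

text \<open>Read along an orbit of \<open>T\<close>, this says that the norms of the iterates are
  log-convex.\<close>

lemma norm_self_adjoint_square:
  assumes "self_adjoint T"
  shows "(norm (T x))\<^sup>2 \<le> norm (T (T x)) * norm x"
proof -
  have "(norm (T x))\<^sup>2 = norm (star x * T (T x))"
    using assms by (metis self_adjoint_def norm_star_mult)
  also have "\<dots> \<le> norm (T (T x)) * norm x"
    by (metis mult.commute norm_mult_ineq norm_star)
  finally show ?thesis .
qed

lemma blinfun_commute_iff: "S o\<^sub>L T = T o\<^sub>L S \<longleftrightarrow> (\<forall>x. S (T x) = T (S x))"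
  by (auto simp: blinfun_apply_inject[symmetric] fun_eq_iff)

lemma closed_self_adjoint: "closed {T :: 'a::cstar_algebra \<Rightarrow>\<^sub>L 'a. self_adjoint T}"
proof -
  have "closed {T :: 'a \<Rightarrow>\<^sub>L 'a. star (T x) * y = star x * T y}" for x y
    by (intro closed_Collect_eq continuous_on_mult continuous_on_const continuous_on_id
        bounded_linear.continuous_on[OF bounded_linear_star] blinfun.continuous_on)
  then show ?thesis unfolding self_adjoint_def by (intro closed_Collect_all)
qed

text \<open>\<open>S\<close> is the power series of \<open>1 - sqrt (1 - L)\<close>, obtained as a fixed point of
  \<open>S \<mapsto> (L + S\<^sup>2) / 2\<close>.\<close>

lemma self_adjoint_sqrt_near_one:
  fixes L :: "'a::cstar_algebra \<Rightarrow>\<^sub>L 'a"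
  assumes L: "self_adjoint L" "norm L < 1"
  obtains S where "self_adjoint S" "2 *\<^sub>R S = L + (S o\<^sub>L S)"
    "\<And>R. R o\<^sub>L L = L o\<^sub>L R \<Longrightarrow> R o\<^sub>L S = S o\<^sub>L R"
proof -
  define f where "f S = (1/2) *\<^sub>R (L + (S o\<^sub>L S))" for S
  \<comment> \<open>Commuting with whatever commutes with \<open>L\<close> is a closed condition
    preserved by \<open>f\<close>; building it into the domain gives it to the fixed point.\<close>
  define Y where "Y = cball 0 (norm L) \<inter> ({S. self_adjoint S} \<inter>
    {S. \<forall>R. R o\<^sub>L L = L o\<^sub>L R \<longrightarrow> R o\<^sub>L S = S o\<^sub>L R})"
  have "closed {S :: 'a \<Rightarrow>\<^sub>L 'a. R o\<^sub>L S = S o\<^sub>L R}" for R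
    by (intro closed_Collect_eq continuous_on_const continuous_on_id
        bounded_bilinear.continuous_on[OF bounded_bilinear_blinfun_compose])
  then have "closed (\<Inter>R\<in>{R. R o\<^sub>L L = L o\<^sub>L R}. {S. R o\<^sub>L S = S o\<^sub>L R})"
    by (rule closed_INT[OF ballI])
  also have "(\<Inter>R\<in>{R. R o\<^sub>L L = L o\<^sub>L R}. {S. R o\<^sub>L S = S o\<^sub>L R})
      = {S. \<forall>R. R o\<^sub>L L = L o\<^sub>L R \<longrightarrow> R o\<^sub>L S = S o\<^sub>L R}" by auto
  finally have "closed {S. \<forall>R. R o\<^sub>L L = L o\<^sub>L R \<longrightarrow> R o\<^sub>L S = S o\<^sub>L R}" .
  then have complete: "complete Y"
    unfolding Y_def complete_eq_closed by (intro closed_Int closed_cball closed_self_adjoint)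
  have Y0: "0 \<in> Y"
    by (simp add: Y_def self_adjoint_def)
  have fY: "f S \<in> Y" if "S \<in> Y" for S
  proof -
    have S: "norm S \<le> norm L" "self_adjoint S"
      "\<And>R. R o\<^sub>L L = L o\<^sub>L R \<Longrightarrow> R o\<^sub>L S = S o\<^sub>L R"
      using that by (auto simp: Y_def)
    have "norm (S o\<^sub>L S) \<le> norm S * norm S"
      by (rule norm_blinfun_compose)
    also have "\<dots> \<le> norm L * 1"
      using S(1) L(2) by (intro mult_mono) auto
    finally have "norm (f S) \<le> norm L"
      unfolding f_def using norm_triangle_ineq[of L "S o\<^sub>L S"] by simp
    moreover have "self_adjoint (f S)"
      unfolding f_def by (intro self_adjoint_scaleR self_adjoint_add self_adjoint_compose L S refl)
    moreover have "R o\<^sub>L f S = f S o\<^sub>L R" if "R o\<^sub>L L = L o\<^sub>L R" for R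
    proof -
      have "R (L x) = L (R x)" "R (S x) = S (R x)" for x
        using that S(3)[OF that] by (simp_all add: blinfun_commute_iff)
      then show ?thesis
        by (auto intro!: blinfun_eqI simp: f_def blinfun.bilinear_simps)
    qed
    ultimately show ?thesis by (simp add: Y_def)
  qed
  have contr: "dist (f S) (f T) \<le> norm L * dist S T" if "S \<in> Y" "T \<in> Y" for S T
  proof -
    have n: "norm S \<le> norm L" "norm T \<le> norm L"
      using that by (auto simp: Y_def)
    have "f S - f T = (1/2) *\<^sub>R ((S o\<^sub>L (S - T)) + ((S - T) o\<^sub>L T))"
      by (auto intro!: blinfun_eqI simp: f_def blinfun.bilinear_simps algebra_simps)
    then have "norm (f S - f T) \<le> (1/2) * (norm (S o\<^sub>L (S - T)) + norm ((S - T) o\<^sub>L T))"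
      using norm_triangle_ineq by simp
    also have "\<dots> \<le> (1/2) * (norm L * norm (S - T) + norm (S - T) * norm L)"
      by (intro mult_left_mono add_mono order_trans[OF norm_blinfun_compose] mult_mono n) auto
    finally show ?thesis by (simp add: dist_norm)
  qed
  have "\<exists>!S. S \<in> Y \<and> f S = S"
    using Y0 fY by (intro Banach_fix[OF complete _ norm_ge_zero L(2) _ contr]) auto
  then obtain S where S: "S \<in> Y" "f S = S" by (elim ex1E conjE)
  have "2 *\<^sub>R f S = L + (S o\<^sub>L S)" by (simp add: f_def)
  then have "2 *\<^sub>R S = L + (S o\<^sub>L S)" unfolding S(2) .
  with S(1) show ?thesis unfolding Y_def by (intro that[of S]) blast+
qed

text \<open>Write \<open>T = t (1 - L)\<close> with \<open>norm L < 1\<close>. Then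
  \<open>2 S = L + S^2\<close> says exactly \<open>(1 - S)^2 = 1 - L\<close>, so
  \<open>sqrt t (1 - S)\<close> is a root.\<close>

lemma self_adjoint_sqrt:
  fixes T :: "'a::cstar_algebra \<Rightarrow>\<^sub>L 'a"
  assumes T: "self_adjoint T" "norm (scalar_op t - T) < t"
  obtains K where "self_adjoint K" "K o\<^sub>L K = T"
    "\<And>R. R o\<^sub>L T = T o\<^sub>L R \<Longrightarrow> R o\<^sub>L K = K o\<^sub>L R"
proof -
  have t: "t > 0" using T(2) norm_ge_zero le_less_trans by blast
  define L where "L = (1/t) *\<^sub>R (scalar_op t - T)"
  have "norm L < 1" using T(2) t by (simp add: L_def)
  moreover have "self_adjoint L"
    unfolding L_def by (intro self_adjoint_scaleR self_adjoint_diff self_adjoint_scalar_op T)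
  ultimately obtain S where S: "self_adjoint S" "2 *\<^sub>R S = L + (S o\<^sub>L S)"
    "\<And>R. R o\<^sub>L L = L o\<^sub>L R \<Longrightarrow> R o\<^sub>L S = S o\<^sub>L R"
    using self_adjoint_sqrt_near_one by blast
  define K where "K = sqrt t *\<^sub>R (id_blinfun - S)"
  have "K (K x) = T x" for x
  proof -
    have "2 *\<^sub>R S x = L x + S (S x)"
      using arg_cong[OF S(2), of "\<lambda>A. blinfun_apply A x"] by (simp add: blinfun.bilinear_simps)
    then have Lx: "L x = 2 *\<^sub>R S x - S (S x)" by simp
    have "T x = t *\<^sub>R x - t *\<^sub>R L x"
      using t by (simp add: L_def blinfun.bilinear_simps)
    then show ?thesis
      unfolding Lx using t
      by (simp add: K_def blinfun.bilinear_simps algebra_simps scaleR_2)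
  qed
  then have "K o\<^sub>L K = T" by (auto intro: blinfun_eqI)
  moreover have "self_adjoint K"
    unfolding K_def using self_adjoint_scalar_op[of 1]
    by (intro self_adjoint_scaleR self_adjoint_diff S) simp
  moreover have "R o\<^sub>L K = K o\<^sub>L R" if "R o\<^sub>L T = T o\<^sub>L R" for R
  proof -
    have "R (T x) = T (R x)" for x
      using that by (simp add: blinfun_commute_iff)
    then have "R o\<^sub>L L = L o\<^sub>L R"
      by (auto intro!: blinfun_eqI simp: L_def blinfun.bilinear_simps)
    from S(3)[OF this] have "R (S x) = S (R x)" for x
      by (simp add: blinfun_commute_iff)
    then show ?thesis by (auto intro!: blinfun_eqI simp: K_def blinfun.bilinear_simps)
  qed
  ultimately show ?thesis using that by blast
qed

text \<open>\<open>K + i N\<close> is \<open>sqrt c\<close> times a unitary, and \<open>K\<^sup>2 - N\<^sup>2\<close> is the real part of its square.\<close>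

lemma norm_diff_squares_le:
  fixes K N :: "'a::cstar_algebra \<Rightarrow>\<^sub>L 'a"
  assumes sa: "self_adjoint K" "self_adjoint N"
    and comm: "K o\<^sub>L N = N o\<^sub>L K"
    and sum: "(K o\<^sub>L K) + (N o\<^sub>L N) = scalar_op c"
    and c: "c \<ge> 0"
  shows "norm ((K o\<^sub>L K) - (N o\<^sub>L N)) \<le> c"
proof (rule norm_blinfun_bound[OF c])
  fix x
  have cm: "K (N y) = N (K y)" for y
    using comm by (simp add: blinfun_commute_iff)
  have sm: "K (K y) + N (N y) = c *\<^sub>R y" for y
    using arg_cong[OF sum, of "\<lambda>A. blinfun_apply A y"] by (simp add: blinfun.bilinear_simps)
  \<comment> \<open>For \<open>j = \<i>\<close> and \<open>j = - \<i>\<close> this is an isometry up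
    to the factor \<open>sqrt c\<close>; in the sum of the two squares the mixed terms cancel,
    leaving \<open>2 (K^2 - N^2)\<close>.\<close>
  define V where "V j y = K y + scaleC j (N y)" for j y
  have V: "(norm (V j y))\<^sup>2 = c * (norm y)\<^sup>2" if j: "cnj j = - j" "j * j = -1" for j y
  proof -
    have "star (V j y) * V j y =
        star (K y) * K y + scaleC j (star (K y) * N y)
        + (scaleC (cnj j) (star (N y) * K y) + scaleC (cnj j * j) (star (N y) * N y))"
      by (simp add: V_def star_add star_scaleC algebra_simps mult_scaleC_left mult_scaleC_right
          scaleC_add_right scaleC_scaleC)
    also have "\<dots> = star y * K (K y) + scaleC j (star y * K (N y))
        + (scaleC (cnj j) (star y * K (N y)) + scaleC (cnj j * j) (star y * N (N y)))"
    proof -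
      have "star (K y) * K y = star y * K (K y)" "star (K y) * N y = star y * K (N y)"
        "star (N y) * K y = star y * K (N y)" "star (N y) * N y = star y * N (N y)"
        using sa cm[of y] unfolding self_adjoint_def by metis+
      then show ?thesis by simp
    qed
    also have "scaleC (cnj j) (star y * K (N y)) = - scaleC j (star y * K (N y))"
      using scaleC_scaleC[of "-1" j "star y * K (N y)"] by (simp add: scaleC_minus_one j(1))
    also have "scaleC (cnj j * j) (star y * N (N y)) = star y * N (N y)"
      using j scaleC_of_real[of 1] by simp
    finally have "star (V j y) * V j y = star y * (K (K y) + N (N y))"
      by (simp add: algebra_simps)
    then show ?thesis
      using norm_star_mult[of "V j y"] norm_star_mult[of y] c by (simp add: sm)
  qed
  have VV: "norm (V j (V j x)) = c * norm x" if j: "cnj j = - j" "j * j = -1" for j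
  proof -
    have "(norm (V j (V j x)))\<^sup>2 = (c * norm x)\<^sup>2"
      using V[OF j] by (simp add: power2_eq_square)
    then show ?thesis using c by (metis norm_ge_zero mult_nonneg_nonneg power2_eq_imp_eq)
  qed
  have exp: "V j (V j x) = K (K x) - N (N x) + scaleC (2 * j) (K (N x))" if "j * j = -1" for j
  proof -
    have "V j (V j x) = K (K x) + (scaleC j (K (N x)) + scaleC j (K (N x)))
        + scaleC (j * j) (N (N x))"
      using sa by (simp add: V_def blinfun.bilinear_simps self_adjoint_scaleC scaleC_add_right
          scaleC_scaleC cm)
    also have "scaleC j (K (N x)) + scaleC j (K (N x)) = scaleC (2 * j) (K (N x))"
      by (simp flip: scaleC_add_left)
    finally show ?thesis using that by (simp add: scaleC_minus_one)
  qed
  have "scaleC (2 * - \<i>) (K (N x)) = - scaleC (2 * \<i>) (K (N x))"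
    using scaleC_scaleC[of "-1" "2 * \<i>" "K (N x)"] by (simp add: scaleC_minus_one)
  then have "2 *\<^sub>R (K (K x) - N (N x)) = V \<i> (V \<i> x) + V (- \<i>) (V (- \<i>) x)"
    by (simp add: exp scaleR_2)
  then have "2 * norm (K (K x) - N (N x)) \<le> norm (V \<i> (V \<i> x)) + norm (V (- \<i>) (V (- \<i>) x))"
    by (metis norm_triangle_ineq norm_scaleR abs_numeral)
  then show "norm (((K o\<^sub>L K) - (N o\<^sub>L N)) x) \<le> c * norm x"
    by (simp add: VV blinfun.bilinear_simps)
qed

section \<open>Positive operators\<close>

text \<open>The slack \<open>d\<close> makes the cone of positive operators closed by definition.\<close>

definition positive_op :: "('a::cstar_algebra \<Rightarrow>\<^sub>L 'a) \<Rightarrow> bool"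
  where "positive_op T \<longleftrightarrow> self_adjoint T \<and>
    (\<forall>d>0. \<exists>t\<ge>0. norm (scalar_op t - T) \<le> t + d)"

text \<open>Allows the witness in \<open>positive_op\<close> to be enlarged beyond any prescribed
  value.\<close>

lemma norm_scalar_op_diff_mono:
  fixes T :: "'a::real_normed_vector \<Rightarrow>\<^sub>L 'a"
  assumes "norm (scalar_op t - T) \<le> t + d" "t \<le> u"
  shows "norm (scalar_op u - T) \<le> u + d"
proof -
  have "scalar_op u - T = (scalar_op t - T) + scalar_op (u - t)"
    by (simp add: scaleR_left_diff_distrib)
  then have "norm (scalar_op u - T) \<le> norm (scalar_op t - T) + norm (scalar_op (u - t) :: 'a \<Rightarrow>\<^sub>L 'a)"
    by (metis norm_triangle_ineq)
  also have "norm (scalar_op (u - t) :: 'a \<Rightarrow>\<^sub>L 'a) \<le> u - t"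
    using assms(2) by (simp add: mult_left_le norm_blinfun_id_le)
  finally show ?thesis using assms(1) by simp
qed

lemma positive_op_self_adjoint: "positive_op T \<Longrightarrow> self_adjoint T"
  by (simp add: positive_op_def)

lemma positive_opE:
  assumes "positive_op T" "d > 0"
  obtains t where "t \<ge> t0" "t \<ge> 0" "norm (scalar_op t - T) \<le> t + d"
proof -
  obtain t where t: "t \<ge> 0" "norm (scalar_op t - T) \<le> t + d"
    using assms by (auto simp: positive_op_def)
  have "norm (scalar_op (max t t0) - T) \<le> max t t0 + d"
    by (rule norm_scalar_op_diff_mono[OF t(2)]) simp
  with t(1) show ?thesis by (intro that[of "max t t0"]) auto
qed

lemma positive_op_add:
  assumes "positive_op S" "positive_op T"
  shows "positive_op (S + T)"
  unfolding positive_op_def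
proof safe
  show "self_adjoint (S + T)"
    using assms by (intro self_adjoint_add positive_op_self_adjoint)
  fix d :: real assume d: "d > 0"
  obtain s where s: "s \<ge> 0" "norm (scalar_op s - S) \<le> s + d / 2"
    using positive_opE[OF assms(1), of "d/2"] d by auto
  obtain t where t: "t \<ge> 0" "norm (scalar_op t - T) \<le> t + d / 2"
    using positive_opE[OF assms(2), of "d/2"] d by auto
  have "scalar_op (s + t) - (S + T) = (scalar_op s - S) + (scalar_op t - T)"
    by (simp add: algebra_simps)
  then have "norm (scalar_op (s + t) - (S + T)) \<le> (s + d/2) + (t + d/2)"
    using s(2) t(2) by (metis norm_triangle_mono)
  then show "\<exists>u\<ge>0. norm (scalar_op u - (S + T)) \<le> u + d"
    using s t by (intro exI[of _ "s + t"]) auto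
qed

lemma positive_op_scaleR:
  assumes "positive_op T" "r \<ge> 0"
  shows "positive_op (r *\<^sub>R T)"
  unfolding positive_op_def
proof safe
  show "self_adjoint (r *\<^sub>R T)"
    using assms by (intro self_adjoint_scaleR positive_op_self_adjoint)
  fix d :: real assume d: "d > 0"
  \<comment> \<open>\<open>r + 1\<close> instead of \<open>r\<close> covers
    \<open>r = 0\<close>.\<close>
  obtain t where t: "t \<ge> 0" "norm (scalar_op t - T) \<le> t + d / (r + 1)"
    using positive_opE[OF assms(1), of "d/(r + 1)"] d assms(2) by auto
  have "scalar_op (r * t) - r *\<^sub>R T = r *\<^sub>R (scalar_op t - T)"
    by (simp add: algebra_simps)
  then have "norm (scalar_op (r * t) - r *\<^sub>R T) \<le> r * (t + d / (r + 1))"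
    using t(2) assms(2) by (simp add: mult_left_mono)
  also have "\<dots> \<le> r * t + d"
    using assms(2) d by (simp add: field_simps)
  finally show "\<exists>u\<ge>0. norm (scalar_op u - r *\<^sub>R T) \<le> u + d"
    using t(1) assms(2) by (intro exI[of _ "r * t"]) auto
qed

lemma positive_op_of_norm_le:
  "\<lbrakk>self_adjoint T; norm (scalar_op t - T) \<le> t\<rbrakk> \<Longrightarrow> positive_op T"
  unfolding positive_op_def by (smt (verit) norm_ge_zero)

lemma positive_op_scalar_minus:
  "\<lbrakk>self_adjoint T; norm T \<le> s\<rbrakk> \<Longrightarrow> positive_op (scalar_op s - T)"
  by (rule positive_op_of_norm_le[of _ s]) (auto intro: self_adjoint_diff self_adjoint_scalar_op)

lemma positive_op_scalar_plus:
  "\<lbrakk>self_adjoint T; norm T \<le> s\<rbrakk> \<Longrightarrow> positive_op (scalar_op s + T)"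
  by (rule positive_op_of_norm_le[of _ s]) (auto intro: self_adjoint_add self_adjoint_scalar_op)

text \<open>Positivity is often available only after a small perturbation \<open>e S\<close>; one of
  norm at most \<open>d / 2\<close> is absorbed by the slack in the definition.\<close>

lemma positive_op_closed:
  assumes T: "self_adjoint T" and S: "positive_op S"
    and lim: "\<And>e. e > 0 \<Longrightarrow> positive_op (T + e *\<^sub>R S)"
  shows "positive_op T"
  unfolding positive_op_def
proof (intro conjI T allI impI)
  fix d :: real assume d: "d > 0"
  define e where "e = d / (2 * (norm S + 1))"
  have e: "e > 0" "e * norm S \<le> d / 2"
    using d by (auto simp: e_def field_simps add_pos_nonneg)
  obtain t where t: "t \<ge> 0" "norm (scalar_op t - (T + e *\<^sub>R S)) \<le> t + d / 2"
    using positive_opE[OF lim[OF e(1)], of "d/2"] d by auto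
  have "scalar_op t - T = (scalar_op t - (T + e *\<^sub>R S)) + e *\<^sub>R S" by simp
  then have "norm (scalar_op t - T) \<le> norm (scalar_op t - (T + e *\<^sub>R S)) + norm (e *\<^sub>R S)"
    by (metis norm_triangle_ineq)
  also have "\<dots> \<le> t + d" using t(2) e by simp
  finally show "\<exists>t\<ge>0. norm (scalar_op t - T) \<le> t + d" using t(1) by blast
qed

text \<open>For \<open>t > norm T\<close> the operator \<open>t - T\<close> has a root
  \<open>N\<close> commuting with \<open>K\<close>, and the bound on \<open>N^2 - K^2\<close> reads
  \<open>norm (t - 2 T) \<le> t\<close>, which gives positivity of \<open>2 T\<close>.\<close>

lemma positive_op_square:
  assumes K: "self_adjoint K"
  shows "positive_op (K o\<^sub>L K)"
proof -
  define T where "T = K o\<^sub>L K"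
  have T: "self_adjoint T"
    unfolding T_def by (rule self_adjoint_compose[OF K K refl])
  define t where "t = norm T + 1"
  have "self_adjoint (scalar_op t - T)"
    by (intro self_adjoint_diff self_adjoint_scalar_op T)
  moreover have "norm (scalar_op t - (scalar_op t - T)) < t"
    by (simp add: t_def)
  ultimately obtain N where N: "self_adjoint N" "N o\<^sub>L N = scalar_op t - T"
    "\<And>R. R o\<^sub>L (scalar_op t - T) = (scalar_op t - T) o\<^sub>L R \<Longrightarrow> R o\<^sub>L N = N o\<^sub>L R"
    by (rule self_adjoint_sqrt) blast
  have "N o\<^sub>L K = K o\<^sub>L N"
    by (rule N(3)[symmetric]) (auto intro!: blinfun_eqI simp: T_def blinfun.bilinear_simps)
  then have "norm ((N o\<^sub>L N) - (K o\<^sub>L K)) \<le> t"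
    by (intro norm_diff_squares_le N K) (auto simp: N(2) T_def[symmetric] t_def)
  then have "norm (scalar_op t - 2 *\<^sub>R T) \<le> t"
    by (simp add: N(2) T_def[symmetric] scaleR_2 algebra_simps)
  then have "positive_op (2 *\<^sub>R T)"
    by (intro positive_op_of_norm_le self_adjoint_scaleR T)
  then have "positive_op ((1/2) *\<^sub>R 2 *\<^sub>R T)" by (rule positive_op_scaleR) simp
  then show ?thesis by (simp add: T_def)
qed

text \<open>\<open>s + T\<close> and \<open>s - T\<close>, both shifted by \<open>e\<close>, have
  commuting roots \<open>K\<close> and \<open>N\<close> with \<open>K^2 + N^2 = 2 (s + e)\<close>
  and \<open>K^2 - N^2 = 2 T\<close>.\<close>

lemma norm_le_of_positive_op:
  assumes "positive_op (scalar_op s - T)" "positive_op (scalar_op s + T)" "s \<ge> 0"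
    and T: "self_adjoint T"
  shows "norm T \<le> s"
proof (rule field_le_epsilon)
  fix e :: real assume e: "e > 0"
  \<comment> \<open>Slack \<open>e / 2\<close> against a shift by \<open>e\<close> leaves the strict
    inequality that the square root requires.\<close>
  define d where "d = e / 2"
  have d: "d > 0" using e by (simp add: d_def)
  have sqrt: "\<exists>K. self_adjoint K \<and> K o\<^sub>L K = S + scalar_op e \<and>
      (\<forall>R. R o\<^sub>L S = S o\<^sub>L R \<longrightarrow> R o\<^sub>L K = K o\<^sub>L R)" if S: "positive_op S" for S :: "'a \<Rightarrow>\<^sub>L 'a"
  proof -
    obtain t where t: "t \<ge> 0" "norm (scalar_op t - S) \<le> t + d"
      using positive_opE[OF S d] by blast
    have "norm (scalar_op (t + e) - (S + scalar_op e)) < t + e"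
      using t e by (simp add: d_def scaleR_left_distrib)
    moreover have "self_adjoint (S + scalar_op e)"
      by (intro self_adjoint_add self_adjoint_scalar_op positive_op_self_adjoint S)
    ultimately obtain K where K: "self_adjoint K" "K o\<^sub>L K = S + scalar_op e"
      "\<And>R. R o\<^sub>L (S + scalar_op e) = (S + scalar_op e) o\<^sub>L R \<Longrightarrow> R o\<^sub>L K = K o\<^sub>L R"
      using self_adjoint_sqrt by blast
    have "R o\<^sub>L K = K o\<^sub>L R" if "R o\<^sub>L S = S o\<^sub>L R" for R
    proof (rule K(3))
      have "R (S x) = S (R x)" for x using that by (simp add: blinfun_commute_iff)
      then show "R o\<^sub>L (S + scalar_op e) = (S + scalar_op e) o\<^sub>L R"
        by (auto intro!: blinfun_eqI simp: blinfun.bilinear_simps)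
    qed
    with K show ?thesis by blast
  qed
  obtain K where K: "self_adjoint K" "K o\<^sub>L K = scalar_op s + T + scalar_op e"
    "\<And>R. R o\<^sub>L (scalar_op s + T) = (scalar_op s + T) o\<^sub>L R \<Longrightarrow> R o\<^sub>L K = K o\<^sub>L R"
    using sqrt[OF assms(2)] by blast
  obtain N where N: "self_adjoint N" "N o\<^sub>L N = scalar_op s - T + scalar_op e"
    "\<And>R. R o\<^sub>L (scalar_op s - T) = (scalar_op s - T) o\<^sub>L R \<Longrightarrow> R o\<^sub>L N = N o\<^sub>L R"
    using sqrt[OF assms(1)] by blast
  \<comment> \<open>The roots commute in two moves: \<open>T\<close> commutes with
    \<open>s + T\<close>, hence with \<open>K\<close>; then \<open>K\<close> commutes with
    \<open>s - T\<close>, hence with \<open>N\<close>.\<close>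
  have "T o\<^sub>L K = K o\<^sub>L T"
    by (rule K(3)) (auto intro!: blinfun_eqI simp: blinfun.bilinear_simps)
  then have "T (K x) = K (T x)" for x by (simp add: blinfun_commute_iff)
  then have "K o\<^sub>L N = N o\<^sub>L K"
    by (intro N(3)) (auto intro!: blinfun_eqI simp: blinfun.bilinear_simps)
  moreover have "(K o\<^sub>L K) + (N o\<^sub>L N) = scalar_op (2 * s + 2 * e)"
    unfolding K N by (auto intro!: blinfun_eqI simp: blinfun.bilinear_simps algebra_simps
        simp flip: scaleR_2)
  ultimately have "norm ((K o\<^sub>L K) - (N o\<^sub>L N)) \<le> 2 * s + 2 * e"
    using assms(3) e by (intro norm_diff_squares_le K(1) N(1)) auto
  also have "(K o\<^sub>L K) - (N o\<^sub>L N) = 2 *\<^sub>R T"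
    unfolding K N by (simp add: scaleR_2)
  finally show "norm T \<le> s + e" by simp
qed

section \<open>Positivity of \<open>a* a\<close>\<close>

lemma lmult_add: "lmult (a + b) = lmult a + lmult b"
  by (auto intro!: blinfun_eqI simp: blinfun.bilinear_simps algebra_simps)

lemma lmult_scaleR: "lmult (r *\<^sub>R a) = r *\<^sub>R lmult a"
  by (auto intro!: blinfun_eqI simp: blinfun.bilinear_simps)

lemma lmult_mult: "lmult (a * b) = lmult a o\<^sub>L lmult b"
  by (auto intro!: blinfun_eqI simp: mult.assoc)

text \<open>For the lower bound \<open>star a\<close> serves as test vector, since there may be no
  unit.\<close>

lemma norm_lmult: "norm (lmult a) = norm (a::'a::cstar_algebra)"
proof (rule antisym)
  show "norm (lmult a) \<le> norm a"
    by (rule norm_blinfun_bound) (auto intro: norm_mult_ineq)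
  have "norm a * norm a \<le> norm (lmult a) * norm a"
    using norm_blinfun[of "lmult a" "star a"] by (simp add: norm_mult_star power2_eq_square)
  then show "norm a \<le> norm (lmult a)"
    by (cases "a = 0") auto
qed

lemma positive_op_scalar: "r \<ge> 0 \<Longrightarrow> positive_op (scalar_op r)"
  by (rule positive_op_of_norm_le[of _ r]) (auto intro: self_adjoint_scalar_op)

text \<open>For self-adjoint \<open>T\<close> the ratios of consecutive norms of \<open>T\<^sup>n y\<close> increase, so the exponential
  growth rate bounds the first one.\<close>

lemma self_adjoint_norm_le_growth:
  assumes T: "self_adjoint T" and l: "l > 0"
    and growth: "\<And>n. norm ((blinfun_apply T ^^ n) y) \<le> C * l ^ n"
  shows "norm (T y) \<le> l * norm y"
proof (rule ccontr)
  define a where "a n = norm ((blinfun_apply T ^^ n) y)" for n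
  assume "\<not> norm (T y) \<le> l * norm y"
  then have a01: "a 1 > l * a 0" by (simp add: a_def)
  have conv: "(a (Suc n))\<^sup>2 \<le> a (Suc (Suc n)) * a n" for n
    using norm_self_adjoint_square[OF T, of "(blinfun_apply T ^^ n) y"] by (simp add: a_def)
  have "a 0 \<noteq> 0"
    using a01 by (auto simp: a_def)
  then have a0: "a 0 > 0" by (simp add: a_def)
  define q where "q = a 1 / a 0"
  have q: "q > l" using a01 a0 by (simp add: q_def field_simps)
  have step: "a n > 0 \<and> a (Suc n) \<ge> q * a n" for n
  proof (induction n)
    case 0
    then show ?case using a0 by (simp add: q_def)
  next
    case (Suc n)
    then have an: "a n > 0" and le: "q * a n \<le> a (Suc n)" by auto
    then have pos: "a (Suc n) > 0"
      using q l by (smt (verit) mult_pos_pos)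
    have "(q * a (Suc n)) * a n \<le> a (Suc n) * a (Suc n)"
      using le pos by (metis mult.commute mult.left_commute mult_right_mono less_imp_le)
    also have "\<dots> \<le> a (Suc (Suc n)) * a n"
      using conv[of n] by (simp add: power2_eq_square)
    finally show ?case using an pos by simp
  qed
  have pow: "q ^ n * a 0 \<le> a n" for n
  proof (induction n)
    case (Suc n)
    have "q ^ Suc n * a 0 \<le> q * a n"
      using Suc q l by (simp add: mult.assoc mult_left_mono)
    also have "\<dots> \<le> a (Suc n)" using step[of n] by blast
    finally show ?case .
  qed simp
  have "1 < q / l" using q l by simp
  then obtain n where n: "C / a 0 < (q / l) ^ n"
    using real_arch_pow by blast
  have "q ^ n * a 0 \<le> C * l ^ n"
    using pow[of n] growth[of n] by (simp add: a_def)
  with n a0 l show False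
    by (simp add: field_simps power_divide)
qed

text \<open>\<open>a* a\<close> and \<open>a a*\<close> have the same lower spectral bound below \<open>0\<close>, because
  \<open>(t - a* a)\<^sup>n a* = a* (t - a a*)\<^sup>n\<close>.\<close>

lemma positive_op_swap:
  fixes a :: "'a::cstar_algebra"
  assumes pos: "positive_op (scalar_op s + lmult (a * star a))" and s: "s \<ge> 0"
  shows "positive_op (scalar_op s + lmult (star a * a))"
  unfolding positive_op_def
proof (intro conjI allI impI)
  show "self_adjoint (scalar_op s + lmult (star a * a))"
    by (intro self_adjoint_add self_adjoint_scalar_op self_adjoint_lmult)
      (simp add: star_mult star_star)
  fix d :: real assume d: "d > 0"
  obtain t where t: "t \<ge> s" "t \<ge> 0"
    "norm (scalar_op t - (scalar_op s + lmult (a * star a))) \<le> t + d"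
    using positive_opE[OF pos d, of s] by blast
  define u where "u = t - s"
  define l where "l = t + d"
  have u: "u \<ge> 0" "u < l" using t(1) s d by (auto simp: u_def l_def)
  define M where "M = scalar_op u - lmult (a * star a)"
  define T where "T = scalar_op u - lmult (star a * a)"
  have M: "norm M \<le> l"
    using t(3) by (simp add: M_def u_def l_def scaleR_left_diff_distrib algebra_simps)
  have T: "self_adjoint T"
    unfolding T_def by (intro self_adjoint_diff self_adjoint_scalar_op self_adjoint_lmult)
      (simp add: star_mult star_star)
  have swap: "(blinfun_apply T ^^ n) (star a * b) = star a * (blinfun_apply M ^^ n) b" for n b
    by (induction n) (simp_all add: T_def M_def blinfun.bilinear_simps algebra_simps)
  have Mn: "norm ((blinfun_apply M ^^ n) b) \<le> l ^ n * norm b" for n b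
  proof (induction n)
    case (Suc n)
    have "norm ((blinfun_apply M ^^ Suc n) b) \<le> norm M * norm ((blinfun_apply M ^^ n) b)"
      by (simp add: norm_blinfun)
    also have "\<dots> \<le> l * (l ^ n * norm b)"
      using Suc M u by (intro mult_mono) auto
    finally show ?case by (simp add: mult.assoc)
  qed simp
  have lin: "(blinfun_apply T ^^ n) (r *\<^sub>R x - y) =
      r *\<^sub>R (blinfun_apply T ^^ n) x - (blinfun_apply T ^^ n) y" for n r x y
    by (induction n) (simp_all add: blinfun.bilinear_simps)
  have "norm (T y) \<le> l * norm y" for y
  proof (rule self_adjoint_norm_le_growth[OF T])
    show "l > 0" using u by simp
    define E where "E = norm a * norm a * norm y"
    \<comment> \<open>Chosen so that \<open>u C + E \<le> l C\<close>, which drives the induction;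
      the summand \<open>norm y\<close> settles \<open>n = 0\<close>.\<close>
    define C where "C = norm y + E / (l - u)"
    have "C * (l - u) = norm y * (l - u) + E"
      using u by (simp add: C_def distrib_right)
    then have E: "E \<le> C * (l - u)" using u by simp
    have C: "C \<ge> 0" using u by (simp add: C_def E_def)
    show "norm ((blinfun_apply T ^^ n) y) \<le> C * l ^ n" for n
    proof (induction n)
      case 0
      then show ?case using u by (simp add: C_def E_def)
    next
      case (Suc n)
      \<comment> \<open>\<open>y\<close> need not be of the form \<open>star a * b\<close>; peeling
        off one factor \<open>T\<close> produces such a term, to which the intertwining with
        \<open>M\<close> applies.\<close>
      have "(blinfun_apply T ^^ Suc n) y = (blinfun_apply T ^^ n) (u *\<^sub>R y - star a * (a * y))"
        by (simp add: funpow_swap1 T_def blinfun.bilinear_simps mult.assoc)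
      also have "\<dots> = u *\<^sub>R (blinfun_apply T ^^ n) y - star a * (blinfun_apply M ^^ n) (a * y)"
        by (simp add: lin swap)
      also have "norm \<dots> \<le> u * norm ((blinfun_apply T ^^ n) y)
          + norm (star a * (blinfun_apply M ^^ n) (a * y))"
        using norm_triangle_ineq4 u(1) by (metis abs_of_nonneg norm_scaleR)
      also have "norm (star a * (blinfun_apply M ^^ n) (a * y)) \<le> norm a * (l ^ n * norm (a * y))"
        using norm_mult_ineq[of "star a"] Mn[of n "a * y"]
        by (smt (verit) mult_left_mono norm_ge_zero norm_star)
      also have "norm a * (l ^ n * norm (a * y)) \<le> norm a * (l ^ n * (norm a * norm y))"
        using u by (intro mult_left_mono norm_mult_ineq) auto
      also have "u * norm ((blinfun_apply T ^^ n) y) \<le> u * (C * l ^ n)"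
        using Suc u by (intro mult_left_mono)
      also have "u * (C * l ^ n) + norm a * (l ^ n * (norm a * norm y)) = (u * C + E) * l ^ n"
        by (simp add: E_def algebra_simps)
      also have "\<dots> \<le> (C * l) * l ^ n"
        using E u by (intro mult_right_mono) (auto simp: algebra_simps)
      finally show ?case by (simp add: mult.assoc)
    qed
  qed
  then have "norm T \<le> l"
    using u by (intro norm_blinfun_bound) auto
  then show "\<exists>t\<ge>0. norm (scalar_op t - (scalar_op s + lmult (star a * a))) \<le> t + d"
    using t(2) by (intro exI[of _ t])
      (simp add: T_def u_def l_def scaleR_left_diff_distrib algebra_simps)
qed

text \<open>
  Kaplansky's argument in quantitative form. Suppose \<open>c* c \<ge> -s\<close> whenever \<open>c\<close> is a strict
  contraction. With \<open>h = c* c\<close>, the element \<open>c' = c (1 - h)\<close> has \<open>c'* c' = h (1 - h)\<^sup>2 \<le> 1/2\<close>. Since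
  \<open>c'* c' + c' c'*\<close> is a sum of squares, \<open>c' c'* \<ge> -1/2\<close>, hence \<open>c'* c' \<ge> -1/2\<close> by swapping, and
  the hypothesis applied to \<open>sqrt (3/2) c'\<close> gives \<open>h \<ge> h (1 - h)\<^sup>2 \<ge> -2s/3\<close>.
\<close>

lemma positive_op_star_mult_improve:
  fixes c :: "'a::cstar_algebra"
  assumes IH: "\<And>c :: 'a. norm c < 1 \<Longrightarrow> positive_op (scalar_op s + lmult (star c * c))"
    and c: "norm c < 1"
  shows "positive_op (scalar_op (2/3 * s) + lmult (star c * c))"
proof -
  define h where "h = star c * c"
  have h: "star h = h" by (simp add: h_def star_mult star_star)
  have nh: "norm h < 1"
    using c by (simp add: h_def norm_star_mult power_less_one_iff)
  have sah: "self_adjoint (lmult h)" by (rule self_adjoint_lmult[OF h])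
  have sqrt: "\<exists>W. self_adjoint W \<and> W o\<^sub>L W = scalar_op r - lmult h \<and> (\<forall>x. h * W x = W (h * x))"
    if r: "r \<ge> 1" for r
  proof -
    have "norm (scalar_op r - (scalar_op r - lmult h)) < r"
      using nh r by (simp add: norm_lmult)
    moreover have "self_adjoint (scalar_op r - lmult h)"
      by (intro self_adjoint_diff self_adjoint_scalar_op sah)
    ultimately obtain W where W: "self_adjoint W" "W o\<^sub>L W = scalar_op r - lmult h"
      "\<And>R. R o\<^sub>L (scalar_op r - lmult h) = (scalar_op r - lmult h) o\<^sub>L R \<Longrightarrow> R o\<^sub>L W = W o\<^sub>L R"
      using self_adjoint_sqrt by blast
    have "lmult h o\<^sub>L W = W o\<^sub>L lmult h"
      by (rule W(3)) (auto intro!: blinfun_eqI simp: blinfun.bilinear_simps algebra_simps)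
    then have "\<forall>x. h * W x = W (h * x)" by (simp add: blinfun_commute_iff)
    with W(1,2) show ?thesis by blast
  qed
  have sq: "positive_op (lmult (b * b))" if "star b = b" for b :: 'a
    unfolding lmult_mult by (intro positive_op_square self_adjoint_lmult that)
  define c' where "c' = c - c * h"
  define h' where "h' = star c' * c'"
  have h': "star h' = h'" by (simp add: h'_def star_mult star_star)
  have h'_eq: "h' = h - (h * h + h * h) + h * h * h"
  proof -
    have "star c' = star c - h * star c"
      by (simp add: c'_def star_diff star_mult h)
    then have "h' = star c * c - star c * c * h - h * (star c * c) + h * (star c * c) * h"
      unfolding h'_def by (simp only:) (simp add: c'_def algebra_simps)
    then show ?thesis by (simp add: mult.assoc flip: h_def)
  qed

  \<comment> \<open>1/2 - h (1 - h)^2 = (1/2 - h)^2 (1 - h) + (1 + h)/4. Both terms are positive by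
    \<open>norm h < 1\<close> alone, before anything is known about the sign of
    \<open>h\<close>.\<close>
  have upper: "positive_op (scalar_op (1/2) - lmult h')"
  proof -
    obtain W where W: "self_adjoint W" "W o\<^sub>L W = scalar_op 1 - lmult h"
      "\<And>x. h * W x = W (h * x)"
      using sqrt[of 1] by auto
    have WW: "W (W x) = x - h * x" for x
      using arg_cong[OF W(2), of "\<lambda>A. blinfun_apply A x"] by (simp add: blinfun.bilinear_simps)
    define G where "G = scalar_op (1/2) - lmult h"
    have G: "self_adjoint G"
      unfolding G_def by (intro self_adjoint_diff self_adjoint_scalar_op sah)
    have GW: "G o\<^sub>L W = W o\<^sub>L G"
      by (auto intro!: blinfun_eqI simp: G_def blinfun.bilinear_simps W(3))
    have "positive_op ((G o\<^sub>L W) o\<^sub>L (G o\<^sub>L W))"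
      by (intro positive_op_square self_adjoint_compose G W GW)
    moreover have "positive_op ((1/4) *\<^sub>R (scalar_op 1 + lmult h))"
      using nh by (intro positive_op_scaleR positive_op_scalar_plus sah) (auto simp: norm_lmult)
    ultimately have "positive_op (((G o\<^sub>L W) o\<^sub>L (G o\<^sub>L W)) + (1/4) *\<^sub>R (scalar_op 1 + lmult h))"
      by (rule positive_op_add)
    also have "((G o\<^sub>L W) o\<^sub>L (G o\<^sub>L W)) + (1/4) *\<^sub>R (scalar_op 1 + lmult h)
        = scalar_op (1/2) - lmult h'"
    proof (rule blinfun_eqI)
      fix x
      have "((G o\<^sub>L W) o\<^sub>L (G o\<^sub>L W)) x = G (G (W (W x)))"
        using GW by (simp add: blinfun_commute_iff)
      also have "\<dots> = (1/4) *\<^sub>R x - (5/4) *\<^sub>R (h * x) + 2 *\<^sub>R (h * (h * x)) - h * (h * (h * x))"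
      proof -
        have "norm (G (G (W (W x))) - ((1/4) *\<^sub>R x - (5/4) *\<^sub>R (h * x) + 2 *\<^sub>R (h * (h * x))
            - h * (h * (h * x)))) \<le> 0"
          unfolding WW G_def
          by (simp add: blinfun.bilinear_simps right_diff_distrib del: norm_le_zero_iff) norm
        then show ?thesis by simp
      qed
      finally have e: "((G o\<^sub>L W) o\<^sub>L (G o\<^sub>L W)) x =
        (1/4) *\<^sub>R x - (5/4) *\<^sub>R (h * x) + 2 *\<^sub>R (h * (h * x)) - h * (h * (h * x))" .
      have "norm ((((G o\<^sub>L W) o\<^sub>L (G o\<^sub>L W)) + (1/4) *\<^sub>R (scalar_op 1 + lmult h)) x
        - (scalar_op (1/2) - lmult h') x) \<le> 0"
        unfolding blinfun.add_left e
        by (simp add: blinfun.bilinear_simps h'_eq algebra_simps del: norm_le_zero_iff) norm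
      then show "(((G o\<^sub>L W) o\<^sub>L (G o\<^sub>L W)) + (1/4) *\<^sub>R (scalar_op 1 + lmult h)) x
        = (scalar_op (1/2) - lmult h') x" by simp
    qed
    finally show ?thesis .
  qed

  have "positive_op (scalar_op (1/2) + lmult (c' * star c'))"
  proof -
    \<comment> \<open>\<open>u\<close> and \<open>v\<close> are, up to sign, twice the real and
      imaginary parts of \<open>c'\<close>; their squares add up to twice
      \<open>star c' * c' + c' * star c'\<close>.\<close>
    define u where "u = c' + star c'"
    define v where "v = scaleC \<i> (c' - star c')"
    have "star u = u" by (simp add: u_def star_add star_star)
    moreover have "star v = v"
    proof -
      have "star v = scaleC (- \<i>) (star c' - c')"
        by (simp add: v_def star_scaleC star_diff star_star)
      also have "\<dots> = scaleC \<i> (scaleC (-1) (star c' - c'))"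
        by (simp add: scaleC_scaleC)
      also have "\<dots> = v" by (simp add: scaleC_minus_one v_def)
      finally show ?thesis .
    qed
    ultimately have "positive_op ((1/2) *\<^sub>R (lmult (u * u) + lmult (v * v)))"
      by (intro positive_op_scaleR positive_op_add sq) auto
    also have "(1/2) *\<^sub>R (lmult (u * u) + lmult (v * v)) = lmult h' + lmult (c' * star c')"
    proof -
      have "v * v = - ((c' - star c') * (c' - star c'))"
        by (simp add: v_def mult_scaleC_left mult_scaleC_right scaleC_scaleC scaleC_minus_one)
      then have "u * u + v * v = 2 *\<^sub>R (h' + c' * star c')"
        by (simp add: u_def h'_def algebra_simps scaleR_2)
      then show ?thesis by (simp add: lmult_scaleR flip: lmult_add)
    qed
    finally have "positive_op (lmult h' + lmult (c' * star c'))" .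
    from positive_op_add[OF upper this] show ?thesis by simp
  qed
  then have lower: "positive_op (scalar_op (1/2) + lmult h')"
    unfolding h'_def by (rule positive_op_swap) simp
  have nh': "norm h' \<le> 1/2"
    using norm_le_of_positive_op[OF upper lower] h' by (simp add: self_adjoint_lmult norm_lmult)

  \<comment> \<open>The bound 1/2 on \<open>h'\<close> leaves room to scale it by 3/2 and stay below
    1; this is the source of the gain 2/3.\<close>
  define e where "e = sqrt (3/2) *\<^sub>R c'"
  have e: "star e * e = (3/2) *\<^sub>R h'"
    by (simp add: e_def star_scaleR h'_def)
  have "(norm e)\<^sup>2 < 1"
    using norm_star_mult[of e] nh' unfolding e by simp
  then have "norm e < 1" by (simp add: power_less_one_iff abs_square_less_1)
  from IH[OF this] have "positive_op ((2/3) *\<^sub>R (scalar_op s + lmult (star e * e)))"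
    by (rule positive_op_scaleR) simp
  then have *: "positive_op (scalar_op (2/3 * s) + lmult h')"
    by (simp add: e lmult_scaleR scaleR_right_distrib)
  \<comment> \<open>\<open>h - h' = 2 h^2 - h^3 = h (2 - h) h\<close>, a square once
    \<open>2 - h\<close> has a root commuting with \<open>h\<close>.\<close>
  obtain V where V: "self_adjoint V" "V o\<^sub>L V = scalar_op 2 - lmult h"
    "\<And>x. h * V x = V (h * x)"
    using sqrt[of 2] by auto
  have VV: "V (V x) = 2 *\<^sub>R x - h * x" for x
    using arg_cong[OF V(2), of "\<lambda>A. blinfun_apply A x"] by (simp add: blinfun.bilinear_simps)
  have "positive_op ((lmult h o\<^sub>L V) o\<^sub>L (lmult h o\<^sub>L V))"
    by (intro positive_op_square self_adjoint_compose sah V)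
      (auto intro!: blinfun_eqI simp: V(3))
  also have "(lmult h o\<^sub>L V) o\<^sub>L (lmult h o\<^sub>L V) = lmult h - lmult h'"
    by (auto intro!: blinfun_eqI simp: blinfun.bilinear_simps VV h'_eq algebra_simps scaleR_2
        simp flip: V(3))
  finally have "positive_op (lmult h - lmult h')" .
  from positive_op_add[OF * this] show ?thesis by (simp add: h_def)
qed

text \<open>From the trivial lower bound -1, the improvement step gives \<open>-(2/3)^n\<close> for
  every strict contraction; closedness lets \<open>n\<close> grow, and scaling treats general
  \<open>a\<close>.\<close>

lemma positive_op_star_mult: "positive_op (lmult (star a * a))"
  for a :: "'a::cstar_algebra"
proof -
  have pow: "positive_op (scalar_op ((2/3)^n) + lmult (star c * c))" if "norm c < 1" for n and c :: 'a
    using that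
  proof (induction n arbitrary: c)
    case 0
    then show ?case
      by (intro positive_op_scalar_plus self_adjoint_lmult)
        (auto simp: star_mult star_star norm_lmult norm_star_mult power_le_one)
  next
    case (Suc n)
    show ?case using positive_op_star_mult_improve[OF Suc.IH Suc.prems] by simp
  qed
  have small: "positive_op (lmult (star c * c))" if c: "norm c < 1" for c :: 'a
  proof (rule positive_op_closed[OF _ positive_op_scalar[of 1]])
    show "self_adjoint (lmult (star c * c))"
      by (rule self_adjoint_lmult) (simp add: star_mult star_star)
    fix e :: real assume "e > 0"
    then obtain n where n: "(2/3)^n < e"
      using real_arch_pow_inv[of e "2/3"] by auto
    have "positive_op ((scalar_op ((2/3)^n) + lmult (star c * c)) + scalar_op (e - (2/3)^n))"
      using n by (intro positive_op_add pow[OF c] positive_op_scalar) auto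
    then show "positive_op (lmult (star c * c) + e *\<^sub>R scalar_op 1)"
      by (simp add: scaleR_left_diff_distrib)
  qed simp
  define r where "r = norm a + 1"
  have r: "r > 0" by (simp add: r_def add_nonneg_pos)
  have "norm ((1/r) *\<^sub>R a) < 1"
    using r by (simp add: r_def)
  from positive_op_scaleR[OF small[OF this], of "r\<^sup>2"]
  show ?thesis using r by (simp add: star_scaleR power2_eq_square flip: lmult_scaleR)
qed

lemma positive_op_mult_star: "positive_op (lmult (a * star a))"
  for a :: "'a::cstar_algebra"
  using positive_op_star_mult[of "star a"] by (simp add: star_star)

section \<open>Norm and order estimates in the algebra\<close>

text \<open>With \<open>s = norm (p + r)\<close>, the operator \<open>s - p\<close> is the sum of
  \<open>s - (p + r)\<close> and \<open>r\<close>, so \<open>s\<close> bounds \<open>p\<close> from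
  above; from below positivity suffices.\<close>

lemma norm_le_norm_add_positive:
  fixes p r :: "'a::cstar_algebra"
  assumes p: "positive_op (lmult p)" and r: "positive_op (lmult r)"
  shows "norm p \<le> norm (p + r)"
proof -
  have "self_adjoint (lmult (p + r))"
    unfolding lmult_add using assms by (intro self_adjoint_add positive_op_self_adjoint)
  then have "positive_op (scalar_op (norm (p + r)) - lmult (p + r))"
    by (rule positive_op_scalar_minus) (simp add: norm_lmult)
  from positive_op_add[OF this r]
  have "positive_op (scalar_op (norm (p + r)) - lmult p)"
    by (simp add: lmult_add)
  moreover have "positive_op (scalar_op (norm (p + r)) + lmult p)"
    by (intro positive_op_add positive_op_scalar p) simp
  ultimately show ?thesis
    using norm_le_of_positive_op[OF _ _ norm_ge_zero positive_op_self_adjoint[OF p]]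
    by (simp add: norm_lmult)
qed

text \<open>Formally this is \<open>star c * (1 - h) * c\<close>. The root \<open>W\<close> of
  \<open>1 + e - h\<close> is only an operator, but \<open>W c\<close> lies in the algebra and
  \<open>star (W c) * W c\<close> is positive; closedness removes the surplus
  \<open>e\<close>.\<close>

lemma positive_op_conj_diff:
  fixes c h :: "'a::cstar_algebra"
  assumes h: "star h = h" "norm h \<le> 1"
  shows "positive_op (lmult (star c * c - star c * h * c))"
proof (rule positive_op_closed[OF _ positive_op_star_mult[of c]])
  show "self_adjoint (lmult (star c * c - star c * h * c))"
    by (rule self_adjoint_lmult) (simp add: star_diff star_mult star_star h mult.assoc)
  fix e :: real assume e: "e > 0"
  have "norm (scalar_op (1 + e) - (scalar_op (1 + e) - lmult h)) < 1 + e"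
    using h e by (simp add: norm_lmult)
  moreover have "self_adjoint (scalar_op (1 + e) - lmult h)"
    by (intro self_adjoint_diff self_adjoint_scalar_op self_adjoint_lmult h)
  ultimately obtain W where W: "self_adjoint W" "W o\<^sub>L W = scalar_op (1 + e) - lmult h"
    using self_adjoint_sqrt by blast
  have "star (W c) * W c = star c * W (W c)"
    using W(1) by (simp add: self_adjoint_def)
  also have "W (W c) = (1 + e) *\<^sub>R c - h * c"
    using arg_cong[OF W(2), of "\<lambda>A. blinfun_apply A c"] by (simp add: blinfun.bilinear_simps)
  finally have "star (W c) * W c = star c * c - star c * h * c + e *\<^sub>R (star c * c)"
    by (simp add: algebra_simps)
  then show "positive_op (lmult (star c * c - star c * h * c) + e *\<^sub>R lmult (star c * c))"
    using positive_op_star_mult[of "W c"] by (simp add: lmult_add lmult_scaleR)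
qed

text \<open>The constant is the maximum of \<open>t\<^sup>2 - t\<^sup>3\<close> on \<open>[0, 1]\<close>:
  \<open>4/27 - t\<^sup>2 + t\<^sup>3 = t (t - 2/3)\<^sup>2 + (t - 2/3)\<^sup>2 / 3\<close>.\<close>

lemma norm_square_minus_cube_le:
  fixes q :: "'a::cstar_algebra"
  assumes Q: "Q = q * star q" and n: "norm Q \<le> 1"
  shows "norm (Q * Q - Q * Q * Q) \<le> 4/27"
proof -
  define e where "e = Q * Q - Q * Q * Q"
  have Qs: "star Q = Q" by (simp add: Q star_mult star_star)
  have e: "positive_op (lmult e)"
    using positive_op_conj_diff[OF Qs n, of Q] by (simp add: e_def Qs)
  \<comment> \<open>\<open>g\<close> is \<open>(Q - 2/3) q\<close>, so that
    \<open>g * star g\<close> is the summand \<open>Q (Q - 2/3)^2\<close>.\<close>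
  define g where "g = Q * q - (2/3) *\<^sub>R q"
  have g: "g * star g = Q * Q * Q - (4/3) *\<^sub>R (Q * Q) + (4/9) *\<^sub>R Q"
  proof -
    have "g * star g = Q * (q * star q) * Q - (2/3) *\<^sub>R (Q * (q * star q))
        - ((2/3) *\<^sub>R ((q * star q) * Q) - (4/9) *\<^sub>R (q * star q))"
      by (simp add: g_def star_diff star_scaleR star_mult Qs algebra_simps)
    also have "\<dots> = Q * Q * Q - (2/3) *\<^sub>R (Q * Q) - ((2/3) *\<^sub>R (Q * Q) - (4/9) *\<^sub>R Q)"
      by (simp flip: Q)
    finally have "norm (g * star g - (Q * Q * Q - (4/3) *\<^sub>R (Q * Q) + (4/9) *\<^sub>R Q)) \<le> 0"
      by norm
    then show ?thesis by simp
  qed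
  define G where "G = lmult Q - scalar_op (2/3)"
  have "self_adjoint G"
    unfolding G_def by (intro self_adjoint_diff self_adjoint_scalar_op self_adjoint_lmult Qs)
  then have "positive_op (lmult (g * star g) + (1/3) *\<^sub>R (G o\<^sub>L G))"
    by (intro positive_op_add positive_op_mult_star positive_op_scaleR positive_op_square) auto
  also have "lmult (g * star g) + (1/3) *\<^sub>R (G o\<^sub>L G) = scalar_op (4/27) - lmult e"
  proof (rule blinfun_eqI)
    fix x
    have "norm ((lmult (g * star g) + (1/3) *\<^sub>R (G o\<^sub>L G)) x - (scalar_op (4/27) - lmult e) x) \<le> 0"
      unfolding g
      by (simp add: G_def e_def blinfun.bilinear_simps algebra_simps del: norm_le_zero_iff) norm
    then show "(lmult (g * star g) + (1/3) *\<^sub>R (G o\<^sub>L G)) x = (scalar_op (4/27) - lmult e) x"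
      by simp
  qed
  finally have upper: "positive_op (scalar_op (4/27) - lmult e)" .
  have "positive_op (scalar_op (4/27) + lmult e)"
    by (intro positive_op_add positive_op_scalar e) simp
  from norm_le_of_positive_op[OF upper this _ positive_op_self_adjoint[OF e]]
  show ?thesis by (simp add: norm_lmult e_def)
qed

section \<open>Hilbert modules and their duals\<close>

text \<open>The closure properties that the estimates on functionals use; they pass from a module to
  its dual for any \<open>N\<close>, and so reach the bidual.\<close>

locale module_ops =
  fixes X :: "('a::cstar_algebra, 'x, 'm) amodule_scheme" (structure)
  assumes add_closed [simp]: "\<lbrakk>x \<in> carrier X; y \<in> carrier X\<rbrakk> \<Longrightarrow> x \<oplus> y \<in> carrier X"
    and scale_closed [simp]: "x \<in> carrier X \<Longrightarrow> c \<cdot> x \<in> carrier X"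
    and act_closed [simp]: "x \<in> carrier X \<Longrightarrow> x \<triangleleft> a \<in> carrier X"

lemma module_mapD:
  assumes "module_map X f"
  shows "\<lbrakk>x \<in> carrier X; y \<in> carrier X\<rbrakk> \<Longrightarrow> f (x \<oplus>\<^bsub>X\<^esub> y) = f x + f y"
    and "x \<in> carrier X \<Longrightarrow> f (c \<cdot>\<^bsub>X\<^esub> x) = scaleC c (f x)"
    and "x \<in> carrier X \<Longrightarrow> f (x \<triangleleft>\<^bsub>X\<^esub> a) = f x * a"
  using assms by (auto simp: module_map_def)

lemma dual_carrierI:
  assumes "f \<in> extensional (carrier X)" "module_map X f"
    and "\<And>x. x \<in> carrier X \<Longrightarrow> norm (f x) \<le> K * N x"
  shows "f \<in> carrier (dual X N)"
  using assms by (auto simp: dual_def)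

lemma dual_carrierD:
  assumes "f \<in> carrier (dual X N)"
  shows "f \<in> extensional (carrier X)" "module_map X f"
    "\<exists>K. \<forall>x\<in>carrier X. norm (f x) \<le> K * N x"
  using assms by (auto simp: dual_def)

lemma dual_ops_apply:
  assumes "x \<in> carrier X"
  shows "(f \<oplus>\<^bsub>dual X N\<^esub> g) x = f x + g x"
    and "(c \<cdot>\<^bsub>dual X N\<^esub> f) x = scaleC (cnj c) (f x)"
    and "(f \<triangleleft>\<^bsub>dual X N\<^esub> b) x = star b * f x"
  using assms by (auto simp: dual_def)

lemma (in module_ops) module_ops_dual: "module_ops (dual X N)"
proof
  fix f g c b
  assume f: "f \<in> carrier (dual X N)"
  then obtain K where K: "\<And>x. x \<in> carrier X \<Longrightarrow> norm (f x) \<le> K * N x"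
    by (auto simp: dual_def)
  note f' = module_mapD[OF dual_carrierD(2)[OF f]]
  {
    assume g: "g \<in> carrier (dual X N)"
    then obtain L where L: "\<And>x. x \<in> carrier X \<Longrightarrow> norm (g x) \<le> L * N x"
      by (auto simp: dual_def)
    note g' = module_mapD[OF dual_carrierD(2)[OF g]]
    show "f \<oplus>\<^bsub>dual X N\<^esub> g \<in> carrier (dual X N)"
    proof (rule dual_carrierI)
      show "f \<oplus>\<^bsub>dual X N\<^esub> g \<in> extensional (carrier X)" by (simp add: dual_def)
      show "module_map X (f \<oplus>\<^bsub>dual X N\<^esub> g)"
        by (auto simp: module_map_def dual_ops_apply f' g' scaleC_add_right algebra_simps)
      show "norm ((f \<oplus>\<^bsub>dual X N\<^esub> g) x) \<le> (K + L) * N x" if "x \<in> carrier X" for x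
        using K[OF that] L[OF that] norm_triangle_ineq[of "f x" "g x"] that
        by (simp add: dual_ops_apply algebra_simps)
    qed
  }
  show "c \<cdot>\<^bsub>dual X N\<^esub> f \<in> carrier (dual X N)"
  proof (rule dual_carrierI)
    show "c \<cdot>\<^bsub>dual X N\<^esub> f \<in> extensional (carrier X)" by (simp add: dual_def)
    show "module_map X (c \<cdot>\<^bsub>dual X N\<^esub> f)"
      by (auto simp: module_map_def dual_ops_apply f' scaleC_add_right scaleC_scaleC
          mult_scaleC_left mult.commute)
    show "norm ((c \<cdot>\<^bsub>dual X N\<^esub> f) x) \<le> (cmod c * K) * N x" if "x \<in> carrier X" for x
      using mult_left_mono[OF K[OF that], of "cmod c"] that
      by (simp add: dual_ops_apply norm_scaleC mult.assoc)
  qed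
  show "f \<triangleleft>\<^bsub>dual X N\<^esub> b \<in> carrier (dual X N)"
  proof (rule dual_carrierI)
    show "f \<triangleleft>\<^bsub>dual X N\<^esub> b \<in> extensional (carrier X)" by (simp add: dual_def)
    show "module_map X (f \<triangleleft>\<^bsub>dual X N\<^esub> b)"
      by (auto simp: module_map_def dual_ops_apply f' mult_scaleC_right algebra_simps)
    show "norm ((f \<triangleleft>\<^bsub>dual X N\<^esub> b) x) \<le> (norm b * K) * N x" if "x \<in> carrier X" for x
      using mult_left_mono[OF K[OF that], of "norm b"] norm_mult_ineq[of "star b" "f x"] that
      by (simp add: dual_ops_apply mult.assoc)
  qed
qed

sublocale amodule \<subseteq> ops: module_ops X
proof
  interpret G: comm_group "\<lparr>carrier = carrier X, monoid.mult = madd X, monoid.one = mzero X\<rparr>"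
    by (rule add_group)
  show "x \<oplus> y \<in> carrier X" if "x \<in> carrier X" "y \<in> carrier X" for x y
    using G.m_closed[of x y] that by simp
qed (auto intro: scale_closed act_closed)

lemma (in amodule) zero_closed: "\<zero> \<in> carrier X" and zero_add: "\<zero> \<oplus> \<zero> = \<zero>"
proof -
  interpret G: comm_group "\<lparr>carrier = carrier X, monoid.mult = madd X, monoid.one = mzero X\<rparr>"
    by (rule add_group)
  show "\<zero> \<in> carrier X" "\<zero> \<oplus> \<zero> = \<zero>"
    using G.one_closed G.l_one[OF G.one_closed] by simp_all
qed

lemma (in amodule) module_map_zero: "module_map X f \<Longrightarrow> f \<zero> = 0"
  using module_mapD(1)[of X f \<zero> \<zero>] zero_closed zero_add by simp

lemma norm_mult3_ineq: "norm (a * b * c) \<le> norm a * norm b * norm (c::'a::real_normed_algebra)"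
  using norm_mult_ineq[of "a * b" c] mult_right_mono[OF norm_mult_ineq[of a b] norm_ge_zero[of c]]
  by linarith

context hilbert_module
begin

lemma ip_add_left:
  "\<lbrakk>x \<in> carrier X; y \<in> carrier X; z \<in> carrier X\<rbrakk> \<Longrightarrow> \<langle>x \<oplus> y, z\<rangle> = \<langle>x, z\<rangle> + \<langle>y, z\<rangle>"
  by (simp add: ip_add_right star_add flip: ip_star[of z])

lemma ip_scale_left:
  "\<lbrakk>x \<in> carrier X; y \<in> carrier X\<rbrakk> \<Longrightarrow> \<langle>c \<cdot> x, y\<rangle> = scaleC (cnj c) \<langle>x, y\<rangle>"
  by (metis ip_scale_right ip_star ops.scale_closed star_scaleC)

lemma ip_act_left:
  "\<lbrakk>x \<in> carrier X; y \<in> carrier X\<rbrakk> \<Longrightarrow> \<langle>x \<triangleleft> a, y\<rangle> = star a * \<langle>x, y\<rangle>"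
  by (metis ip_act_right ip_star ops.act_closed star_mult)

lemma ip_positive_op: "x \<in> carrier X \<Longrightarrow> positive_op (lmult \<langle>x, x\<rangle>)"
  using ip_positive positive_op_star_mult unfolding cstar_positive_def by fastforce

lemma hnorm_nonneg [simp]: "hnorm X x \<ge> 0"
  by (simp add: hnorm_def)

lemma hnorm_square: "(hnorm X x)\<^sup>2 = norm \<langle>x, x\<rangle>"
  by (simp add: hnorm_def)

lemma hnorm_scale: "x \<in> carrier X \<Longrightarrow> hnorm X (c \<cdot> x) = cmod c * hnorm X x"
  by (simp add: hnorm_def ip_scale_left ip_scale_right scaleC_scaleC norm_scaleC norm_mult
      real_sqrt_mult)

lemma hnorm_act: "x \<in> carrier X \<Longrightarrow> hnorm X (x \<triangleleft> a) \<le> hnorm X x * norm a"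
proof -
  assume x: "x \<in> carrier X"
  have "norm (star a * \<langle>x, x\<rangle> * a) \<le> norm a * norm \<langle>x, x\<rangle> * norm a"
    using norm_mult3_ineq[of "star a" "\<langle>x, x\<rangle>" a] by simp
  then have "(hnorm X (x \<triangleleft> a))\<^sup>2 \<le> (hnorm X x * norm a)\<^sup>2"
    using x by (simp add: hnorm_square ip_act_left ip_act_right power_mult_distrib
        power2_eq_square[of "norm a"] mult_ac)
  then show ?thesis by (rule power2_le_imp_le) simp
qed

lemma hnorm_eq_0: "\<lbrakk>x \<in> carrier X; hnorm X x = 0\<rbrakk> \<Longrightarrow> x = \<zero>"
  using hnorm_square[of x] ip_definite by simp

lemma hnorm_zero [simp]: "hnorm X \<zero> = 0"
  using ip_add_right[OF zero_closed zero_closed zero_closed] zero_add by (simp add: hnorm_def)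

text \<open>This says that \<open>(\<theta>, (1 - \<theta>\<theta>*)\<^bsup>1/2\<^esup>)\<close> is a row contraction, where \<open>\<theta> a = x a\<close>.\<close>

lemma ip_completion:
  fixes \<alpha> :: 'a
  assumes x: "x \<in> carrier X" and y: "y \<in> carrier X"
  defines "p \<equiv> \<langle>x, y\<rangle>"
  defines "v \<equiv> y \<oplus> x \<triangleleft> (\<alpha> - p)"
  shows "star \<alpha> * \<alpha> + \<langle>y, y\<rangle> =
    \<langle>v, v\<rangle> + (star p * p + (star (\<alpha> - p) * (\<alpha> - p) - star (\<alpha> - p) * \<langle>x, x\<rangle> * (\<alpha> - p)))"
proof -
  define g where "g = \<alpha> - p"
  have \<alpha>: "\<alpha> = g + p" by (simp add: g_def)
  have yx: "\<langle>y, x\<rangle> = star p" using x y by (simp add: p_def ip_star)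
  have "\<langle>v, v\<rangle> = \<langle>y, y\<rangle> + star p * g + (star g * p + star g * \<langle>x, x\<rangle> * g)"
    using x y unfolding v_def g_def[symmetric]
    by (simp add: ip_add_left ip_add_right ip_act_left ip_act_right yx p_def[symmetric]
        algebra_simps)
  then show ?thesis
    unfolding g_def[symmetric] unfolding \<alpha> by (simp add: star_add algebra_simps)
qed

text \<open>In the completed square all three terms are positive, the last because
  \<open>norm \<langle>x, x\<rangle> \<le> 1\<close>, so keeping just one of them cannot raise the
  norm.\<close>

lemma ip_completion_norms:
  assumes x: "x \<in> carrier X" "hnorm X x \<le> 1" and y: "y \<in> carrier X"
  shows "norm \<langle>y \<oplus> x \<triangleleft> (\<alpha> - \<langle>x, y\<rangle>), y \<oplus> x \<triangleleft> (\<alpha> - \<langle>x, y\<rangle>)\<rangle> \<le> norm (star \<alpha> * \<alpha> + \<langle>y, y\<rangle>)"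
    and "(norm \<langle>x, y\<rangle>)\<^sup>2 \<le> norm (star \<alpha> * \<alpha> + \<langle>y, y\<rangle>)"
proof -
  define p where "p = \<langle>x, y\<rangle>"
  define v where "v = y \<oplus> x \<triangleleft> (\<alpha> - p)"
  define r where "r = star (\<alpha> - p) * (\<alpha> - p) - star (\<alpha> - p) * \<langle>x, x\<rangle> * (\<alpha> - p)"
  have eq: "star \<alpha> * \<alpha> + \<langle>y, y\<rangle> = \<langle>v, v\<rangle> + (star p * p + r)"
    using ip_completion[OF x(1) y] by (simp add: p_def v_def r_def)
  have v: "v \<in> carrier X" using x y by (simp add: v_def)
  have "norm \<langle>x, x\<rangle> \<le> 1"
    using x(2) by (simp add: power_le_one flip: hnorm_square)
  then have r: "positive_op (lmult r)"
    unfolding r_def using x by (intro positive_op_conj_diff) (auto simp: ip_star)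
  have "norm \<langle>v, v\<rangle> \<le> norm (\<langle>v, v\<rangle> + (star p * p + r))"
    by (intro norm_le_norm_add_positive ip_positive_op v)
      (simp only: lmult_add positive_op_add positive_op_star_mult r)
  then show "norm \<langle>y \<oplus> x \<triangleleft> (\<alpha> - \<langle>x, y\<rangle>), y \<oplus> x \<triangleleft> (\<alpha> - \<langle>x, y\<rangle>)\<rangle> \<le> norm (star \<alpha> * \<alpha> + \<langle>y, y\<rangle>)"
    by (simp add: eq) (simp add: v_def p_def)
  have "norm (star p * p) \<le> norm (star p * p + (\<langle>v, v\<rangle> + r))"
    by (intro norm_le_norm_add_positive positive_op_star_mult)
      (simp only: lmult_add positive_op_add ip_positive_op v r)
  then show "(norm \<langle>x, y\<rangle>)\<^sup>2 \<le> norm (star \<alpha> * \<alpha> + \<langle>y, y\<rangle>)"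
    by (simp add: eq norm_star_mult p_def[symmetric] add.left_commute)
qed

text \<open>For \<open>x\<close> in the unit ball this is the completed square with
  \<open>\<alpha> = 0\<close>; scaling does the rest, and definiteness covers
  \<open>hnorm X x = 0\<close>.\<close>

lemma norm_ip_le:
  assumes x: "x \<in> carrier X" and y: "y \<in> carrier X"
  shows "norm \<langle>x, y\<rangle> \<le> hnorm X x * hnorm X y"
proof -
  have *: "norm \<langle>x, y\<rangle> \<le> hnorm X y" if "x \<in> carrier X" "hnorm X x \<le> 1" for x
  proof (rule power2_le_imp_le)
    show "(norm \<langle>x, y\<rangle>)\<^sup>2 \<le> (hnorm X y)\<^sup>2"
      using ip_completion_norms(2)[OF that y, of 0] by (simp add: hnorm_square)
  qed simp
  show ?thesis
  proof (cases "hnorm X x = 0")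
    case True
    then have "\<langle>x, y\<rangle> = star \<langle>y, \<zero>\<rangle>"
      using x y hnorm_eq_0 by (simp add: ip_star)
    also have "\<langle>y, \<zero>\<rangle> = 0"
      using ip_add_right[OF y zero_closed zero_closed] zero_add by simp
    finally show ?thesis by simp
  next
    case False
    then have pos: "hnorm X x > 0" using hnorm_nonneg[of x] by linarith
    define c where "c = complex_of_real (1 / hnorm X x)"
    have c: "cmod c = 1 / hnorm X x" using pos by (simp add: c_def norm_divide)
    have "norm \<langle>c \<cdot> x, y\<rangle> \<le> hnorm X y"
      using x pos by (intro *) (auto simp: hnorm_scale c)
    then show ?thesis
      using x y pos by (simp add: ip_scale_left norm_scaleC c field_simps)
  qed
qed

text \<open>The row contraction above, composed with \<open>f\<close>, yields \<open>\<parallel>R\<^sup>2\<parallel>\<^sup>2 \<le> \<parallel>R\<^sup>3\<parallel>\<close>.\<close>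

lemma norm_contraction_defect_le_1:
  assumes f: "module_map X f" "\<And>v. v \<in> carrier X \<Longrightarrow> norm (f v) \<le> hnorm X v"
    and x: "x \<in> carrier X" "hnorm X x \<le> 1" and z: "z \<in> carrier X" "hnorm X z \<le> 1"
  defines "\<rho> \<equiv> f z - f x * \<langle>x, z\<rangle>"
  shows "norm (\<rho> * star \<rho> + f x * star (f x)) \<le> 1"
proof -
  note f' = module_mapD[OF f(1)]
  define R where "R = \<rho> * star \<rho> + f x * star (f x)"
  have Rs: "star R = R" by (simp add: R_def star_add star_mult star_star)
  \<comment> \<open>The row \<open>(\<rho>, f x)\<close> is applied to its own adjoint times
    \<open>R\<close>: this gives \<open>f v = R^2\<close> and
    \<open>star \<alpha> * \<alpha> + star c * c = R^3\<close>.\<close>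
  define c where "c = star \<rho> * R"
  define \<alpha> where "\<alpha> = star (f x) * R"
  define y where "y = z \<triangleleft> c"
  have y: "y \<in> carrier X" using z by (simp add: y_def)
  define v where "v = y \<oplus> x \<triangleleft> (\<alpha> - \<langle>x, y\<rangle>)"
  have v: "v \<in> carrier X" using x y by (simp add: v_def)
  have "f v = f z * c + f x * (\<alpha> - \<langle>x, z\<rangle> * c)"
    using x y z by (simp add: v_def f') (simp add: y_def f' ip_act_right)
  also have "\<dots> = \<rho> * c + f x * \<alpha>" by (simp add: \<rho>_def algebra_simps)
  also have "\<dots> = R * R" by (simp add: c_def \<alpha>_def R_def algebra_simps)
  finally have fv: "f v = R * R" .
  have yy: "\<langle>y, y\<rangle> = star c * \<langle>z, z\<rangle> * c"
    using z by (simp add: y_def ip_act_left ip_act_right mult.assoc)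
  have "norm R ^ 4 = (norm (R * R))\<^sup>2"
    using norm_star_mult[of R] by (simp add: Rs)
  also have "\<dots> \<le> (hnorm X v)\<^sup>2"
    using f(2)[OF v] by (simp add: fv power_mono)
  also have "\<dots> = norm \<langle>v, v\<rangle>" by (rule hnorm_square)
  also have "\<dots> \<le> norm (star \<alpha> * \<alpha> + \<langle>y, y\<rangle>)"
    unfolding v_def by (rule ip_completion_norms(1)[OF x y])
  \<comment> \<open>The added term, positive because \<open>z\<close> lies in the unit ball,
    replaces \<open>\<langle>y, y\<rangle>\<close> by \<open>star c * c\<close>.\<close>
  also have "\<dots> \<le> norm ((star \<alpha> * \<alpha> + \<langle>y, y\<rangle>) + (star c * c - star c * \<langle>z, z\<rangle> * c))"
  proof (rule norm_le_norm_add_positive)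
    show "positive_op (lmult (star \<alpha> * \<alpha> + \<langle>y, y\<rangle>))"
      by (simp only: lmult_add positive_op_add positive_op_star_mult ip_positive_op y)
    have "norm \<langle>z, z\<rangle> \<le> 1"
      using z(2) by (simp add: power_le_one flip: hnorm_square)
    then show "positive_op (lmult (star c * c - star c * \<langle>z, z\<rangle> * c))"
      using z by (intro positive_op_conj_diff) (auto simp: ip_star)
  qed
  also have "(star \<alpha> * \<alpha> + \<langle>y, y\<rangle>) + (star c * c - star c * \<langle>z, z\<rangle> * c) = R * R * R"
  proof -
    have "star \<alpha> * \<alpha> + star c * c = R * (\<rho> * star \<rho> + f x * star (f x)) * R"
      by (simp add: \<alpha>_def c_def star_mult star_star Rs algebra_simps)
    then show ?thesis by (simp add: yy R_def[symmetric])
  qed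
  also have "norm (R * R * R) \<le> norm R * norm R * norm R"
    by (rule norm_mult3_ineq)
  finally have "norm R ^ 3 * norm R \<le> norm R ^ 3 * 1"
    by (simp add: power_numeral_reduce mult_ac)
  then have "norm R \<le> 1"
    by (cases "norm R = 0") (simp_all add: mult_le_cancel_left)
  then show ?thesis by (simp add: R_def)
qed

lemma norm_localised_defect_le:
  assumes f: "module_map X f" "\<And>v. v \<in> carrier X \<Longrightarrow> norm (f v) \<le> hnorm X v"
    and x: "x \<in> carrier X" "hnorm X x \<le> 1" and z: "z \<in> carrier X" "hnorm X z \<le> 1"
  defines "Q \<equiv> f x * star (f x)"
  shows "norm (Q * (f z - f x * \<langle>x, z\<rangle>)) \<le> 2/5"
proof -
  define \<rho> where "\<rho> = f z - f x * \<langle>x, z\<rangle>"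
  define R where "R = \<rho> * star \<rho> + Q"
  have R: "norm R \<le> 1" "star R = R"
    using norm_contraction_defect_le_1[OF f x z]
    by (simp_all add: R_def Q_def \<rho>_def star_add star_mult star_star)
  have Qs: "star Q = Q" by (simp add: Q_def star_mult star_star)
  have "norm Q = (norm (f x))\<^sup>2" by (simp add: Q_def norm_mult_star)
  also have "\<dots> \<le> 1" using f(2)[OF x(1)] x(2) by (simp add: power_le_one)
  finally have nQ: "norm Q \<le> 1" .
  have "(norm (Q * \<rho>))\<^sup>2 = norm ((Q * \<rho>) * star (Q * \<rho>))" by (simp only: norm_mult_star)
  \<comment> \<open>The added term is \<open>Q (1 - R) Q\<close>; together with the first term,
    which is \<open>Q (R - Q) Q\<close>, it makes the unknown \<open>R\<close> drop out.\<close>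
  also have "\<dots> \<le> norm ((Q * \<rho>) * star (Q * \<rho>) + (star Q * Q - star Q * R * Q))"
    by (intro norm_le_norm_add_positive positive_op_mult_star positive_op_conj_diff R)
  also have "(Q * \<rho>) * star (Q * \<rho>) + (star Q * Q - star Q * R * Q) = Q * Q - Q * Q * Q"
    by (simp add: R_def star_mult Qs algebra_simps)
  also have "norm \<dots> \<le> 4/27"
    by (rule norm_square_minus_cube_le[OF meta_eq_to_obj_eq[OF Q_def] nQ])
  finally have "(norm (Q * \<rho>))\<^sup>2 \<le> (2/5)\<^sup>2" by (simp add: power2_eq_square)
  then have "norm (Q * \<rho>) \<le> 2/5" by (rule power2_le_imp_le) simp
  then show ?thesis by (simp add: \<rho>_def)
qed

section \<open>The dual and its operator norm\<close>

lemma module_ops_hdual: "module_ops (hdual X)"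
  by (rule ops.module_ops_dual)

lemma hdual_norm_le:
  assumes "\<And>x. \<lbrakk>x \<in> carrier X; hnorm X x \<le> 1\<rbrakk> \<Longrightarrow> norm (f x) \<le> b"
  shows "hdual_norm X f \<le> b"
  unfolding dual_norm_def
proof (rule cSUP_least)
  show "{x \<in> carrier X. hnorm X x \<le> 1} \<noteq> {}"
    using zero_closed hnorm_zero by force
qed (use assms in auto)

lemma norm_hdual_le_unit:
  assumes f: "f \<in> carrier (hdual X)" and x: "x \<in> carrier X" "hnorm X x \<le> 1"
  shows "norm (f x) \<le> hdual_norm X f"
  unfolding dual_norm_def
proof (rule cSUP_upper)
  obtain K where K: "\<And>x. x \<in> carrier X \<Longrightarrow> norm (f x) \<le> K * hnorm X x"
    using dual_carrierD(3)[OF f] by blast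
  have "norm (f y) \<le> \<bar>K\<bar>" if "y \<in> carrier X" "hnorm X y \<le> 1" for y
  proof -
    have "norm (f y) \<le> \<bar>K\<bar> * hnorm X y"
      using K[OF that(1)] by (meson abs_ge_self hnorm_nonneg mult_right_mono order_trans)
    also have "\<dots> \<le> \<bar>K\<bar>" using that(2) by (simp add: mult_left_le)
    finally show ?thesis .
  qed
  then show "bdd_above ((\<lambda>x. norm (f x)) ` {x \<in> carrier X. hnorm X x \<le> 1})"
    by (intro bdd_aboveI2[where M="\<bar>K\<bar>"]) auto
qed (use x in auto)

lemma hdual_norm_nonneg: "f \<in> carrier (hdual X) \<Longrightarrow> hdual_norm X f \<ge> 0"
  by (rule order_trans[OF norm_ge_zero norm_hdual_le_unit[OF _ zero_closed]]) simp_all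

lemma norm_hdual_le:
  assumes f: "f \<in> carrier (hdual X)" and x: "x \<in> carrier X"
  shows "norm (f x) \<le> hdual_norm X f * hnorm X x"
proof (cases "hnorm X x = 0")
  case True
  then have "f x = 0"
    using hnorm_eq_0[OF x] module_map_zero dual_carrierD(2)[OF f] by simp
  then show ?thesis using True by simp
next
  case False
  then have pos: "hnorm X x > 0" using hnorm_nonneg[of x] by linarith
  define c where "c = complex_of_real (1 / hnorm X x)"
  have c: "cmod c = 1 / hnorm X x" using pos by (simp add: c_def norm_divide)
  have "norm (f (c \<cdot> x)) \<le> hdual_norm X f"
    using x pos by (intro norm_hdual_le_unit[OF f]) (auto simp: hnorm_scale c)
  then show ?thesis
    using x pos module_mapD(2)[OF dual_carrierD(2)[OF f] x]
    by (simp add: norm_scaleC c field_simps)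
qed

lemma hat_in_hdual: "x \<in> carrier X \<Longrightarrow> hat X x \<in> carrier (hdual X)"
  by (rule dual_carrierI[where K="hnorm X x"])
    (auto simp: hat_def module_map_def ip_add_right ip_scale_right ip_act_right norm_ip_le)

lemma hdual_norm_hat_le: "x \<in> carrier X \<Longrightarrow> hdual_norm X (hat X x) \<le> hnorm X x"
proof (rule hdual_norm_le)
  fix y assume x: "x \<in> carrier X" and y: "y \<in> carrier X" "hnorm X y \<le> 1"
  have "norm \<langle>x, y\<rangle> \<le> hnorm X x * hnorm X y" by (rule norm_ip_le[OF x y(1)])
  also have "\<dots> \<le> hnorm X x" using y(2) by (simp add: mult_left_le)
  finally show "norm (hat X x y) \<le> hnorm X x" using y by (simp add: hat_def)
qed

end

section \<open>Functionals on modules between \<open>X\<close> and its dual\<close>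

text \<open>
  The key estimate is needed both for functionals on \<open>X'\<close> and for functionals on \<open>X''\<close>. Both modules
  are represented in \<open>X'\<close> by a map \<open>j\<close> whose range contains the copy \<open>j \<circ> d\<close> of \<open>X\<close>.
\<close>

locale dual_representation = hilbert_module X + rep: module_ops Y
  for X :: "('a::cstar_algebra, 'x) ip_module" (structure)
    and Y :: "('a, 'y, 'm) amodule_scheme"
    and j :: "'y \<Rightarrow> 'x \<Rightarrow> 'a"
    and d :: "'x \<Rightarrow> 'y" +
  assumes j_closed: "y \<in> carrier Y \<Longrightarrow> j y \<in> carrier (hdual X)"
    and j_add: "\<lbrakk>y \<in> carrier Y; y' \<in> carrier Y; x \<in> carrier X\<rbrakk> \<Longrightarrow> j (y \<oplus>\<^bsub>Y\<^esub> y') x = j y x + j y' x"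
    and j_scale: "\<lbrakk>y \<in> carrier Y; x \<in> carrier X\<rbrakk> \<Longrightarrow> j (c \<cdot>\<^bsub>Y\<^esub> y) x = scaleC (cnj c) (j y x)"
    and j_act: "\<lbrakk>y \<in> carrier Y; x \<in> carrier X\<rbrakk> \<Longrightarrow> j (y \<triangleleft>\<^bsub>Y\<^esub> b) x = star b * j y x"
    and d_closed: "x \<in> carrier X \<Longrightarrow> d x \<in> carrier Y"
    and j_d: "\<lbrakk>w \<in> carrier X; x \<in> carrier X\<rbrakk> \<Longrightarrow> j (d w) x = \<langle>w, x\<rangle>"
begin

abbreviation jnorm :: "'y \<Rightarrow> real"
  where "jnorm y \<equiv> hdual_norm X (j y)"

lemma jnorm_nonneg: "y \<in> carrier Y \<Longrightarrow> jnorm y \<ge> 0"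
  by (rule hdual_norm_nonneg[OF j_closed])

lemma jnorm_scale_le:
  assumes y: "y \<in> carrier Y"
  shows "jnorm (c \<cdot>\<^bsub>Y\<^esub> y) \<le> cmod c * jnorm y"
proof (rule hdual_norm_le)
  fix x assume x: "x \<in> carrier X" "hnorm X x \<le> 1"
  show "norm (j (c \<cdot>\<^bsub>Y\<^esub> y) x) \<le> cmod c * jnorm y"
    using norm_hdual_le_unit[OF j_closed[OF y] x] x y
    by (simp add: j_scale norm_scaleC mult_left_mono)
qed

text \<open>Rescaling reduces to the unit ball. Where \<open>jnorm y = 0\<close> this is impossible,
  and the a priori bound, however large \<open>K\<close> is, gives
  \<open>\<psi> y = 0\<close>.\<close>

lemma norm_le_jnorm_of_unit:
  assumes \<psi>: "module_map Y \<psi>" "\<And>y. y \<in> carrier Y \<Longrightarrow> norm (\<psi> y) \<le> K * jnorm y"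
    and unit: "\<And>y. \<lbrakk>y \<in> carrier Y; jnorm y \<le> 1\<rbrakk> \<Longrightarrow> norm (\<psi> y) \<le> M"
    and y: "y \<in> carrier Y"
  shows "norm (\<psi> y) \<le> M * jnorm y"
proof (cases "jnorm y = 0")
  case True
  then show ?thesis using \<psi>(2)[OF y] by simp
next
  case False
  then have pos: "jnorm y > 0" using jnorm_nonneg[OF y] by linarith
  define c where "c = complex_of_real (1 / jnorm y)"
  have c: "cmod c = 1 / jnorm y" using pos by (simp add: c_def norm_divide)
  have "jnorm (c \<cdot>\<^bsub>Y\<^esub> y) \<le> 1"
    using jnorm_scale_le[OF y, of c] pos by (simp add: c)
  then have "norm (\<psi> (c \<cdot>\<^bsub>Y\<^esub> y)) \<le> M"
    using y by (intro unit) auto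
  then show ?thesis
    using pos by (simp add: module_mapD(2)[OF \<psi>(1) y] norm_scaleC c field_simps)
qed

text \<open>Localising by \<open>Q = f(x) f(x)*\<close>, an element \<open>f\<close> of the unit ball of \<open>X'\<close> becomes
  close to an element of \<open>X\<close>.\<close>

lemma norm_localised_le:
  assumes \<psi>: "module_map Y \<psi>" "\<And>y. y \<in> carrier Y \<Longrightarrow> norm (\<psi> y) \<le> M * jnorm y" and M: "M \<ge> 0"
    and y: "y \<in> carrier Y" "jnorm y \<le> 1"
    and x: "x \<in> carrier X" "hnorm X x \<le> 1"
  defines "q \<equiv> j y x"
  shows "norm (\<psi> y * (q * star q) - \<psi> (d (x \<triangleleft> (star q * (q * star q))))) \<le> 2/5 * M"
proof -
  define Q where "Q = q * star q"
  have Qs: "star Q = Q" by (simp add: Q_def star_mult star_star)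
  define w where "w = x \<triangleleft> (star q * Q)"
  have w: "w \<in> carrier X" using x by (simp add: w_def)
  \<comment> \<open>Under \<open>j\<close> this becomes
    \<open>z \<mapsto> Q (f z - f x \<langle>x, z\<rangle>)\<close> for \<open>f = j y\<close>, the
    weighted defect bounded by 2/5.\<close>
  define y1 where "y1 = (y \<triangleleft>\<^bsub>Y\<^esub> Q) \<oplus>\<^bsub>Y\<^esub> ((-1) \<cdot>\<^bsub>Y\<^esub> d w)"
  have y1: "y1 \<in> carrier Y" using y w by (simp add: y1_def d_closed)
  have jy: "norm (j y v) \<le> hnorm X v" if "v \<in> carrier X" for v
    using norm_hdual_le[OF j_closed[OF y(1)] that] y(2) mult_right_mono[OF y(2) hnorm_nonneg[of v]]
    by linarith
  have "jnorm y1 \<le> 2/5"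
  proof (rule hdual_norm_le)
    fix z assume z: "z \<in> carrier X" "hnorm X z \<le> 1"
    have "j y1 z = Q * (j y z - q * \<langle>x, z\<rangle>)"
      using x y z w
      by (simp add: y1_def j_add j_act j_scale j_d d_closed Qs scaleC_minus_one)
        (simp add: w_def ip_act_left star_mult star_star Qs algebra_simps)
    then show "norm (j y1 z) \<le> 2/5"
      using norm_localised_defect_le[OF dual_carrierD(2)[OF j_closed[OF y(1)]] jy x z]
      by (simp add: q_def Q_def)
  qed
  then have "M * jnorm y1 \<le> M * (2/5)"
    using M by (rule mult_left_mono)
  then have "norm (\<psi> y1) \<le> 2/5 * M"
    using \<psi>(2)[OF y1] by simp
  also have "\<psi> y1 = \<psi> y * Q - \<psi> (d w)"
    using y w by (simp add: y1_def module_mapD[OF \<psi>(1)] d_closed scaleC_minus_one)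
  finally show ?thesis by (simp add: w_def Q_def)
qed

text \<open>For \<open>y\<close> almost attaining the norm \<open>M\<close> of \<open>\<psi>\<close>, localise \<open>y (\<psi> y)* / M\<close> instead of \<open>y\<close>: then
  \<open>Q\<close> sits where \<open>\<psi> y\<close> is large, so \<open>\<psi>\<close> stays large after localisation.\<close>

lemma norm_le_of_restriction_aux:
  assumes \<psi>: "module_map Y \<psi>" "\<And>y. y \<in> carrier Y \<Longrightarrow> norm (\<psi> y) \<le> M * jnorm y" and M: "M > 0"
    and \<phi>: "\<And>x. x \<in> carrier X \<Longrightarrow> norm (\<psi> (d x)) \<le> \<phi> * hnorm X x" "\<phi> \<ge> 0"
    and y: "y \<in> carrier Y" "jnorm y \<le> 1"
    and r: "r \<ge> 0" "\<phi> + 2/5 * M \<le> M * r ^ 6"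
  shows "(norm (\<psi> y))\<^sup>2 \<le> M\<^sup>2 * r"
proof -
  define h where "h = \<psi> y"
  have nh: "norm h \<le> M"
    using \<psi>(2)[OF y(1)] y(2) M mult_left_mono[of "jnorm y" 1 M] unfolding h_def by linarith
  define m where "m = 1/M"
  define \<sigma> where "\<sigma> = complex_of_real m \<cdot>\<^bsub>Y\<^esub> (y \<triangleleft>\<^bsub>Y\<^esub> star h)"
  have \<sigma>: "\<sigma> \<in> carrier Y" using y by (simp add: \<sigma>_def)
  have j\<sigma>: "j \<sigma> x = (1/M) *\<^sub>R (h * j y x)" if "x \<in> carrier X" for x
    using that y by (simp add: \<sigma>_def j_scale j_act star_star scaleC_of_real flip: m_def)
  have \<psi>\<sigma>: "\<psi> \<sigma> = (1/M) *\<^sub>R (h * star h)"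
    using y by (simp add: \<sigma>_def module_mapD[OF \<psi>(1)] scaleC_of_real h_def flip: m_def)
  have jy1: "norm (j y x) \<le> 1" if "x \<in> carrier X" "hnorm X x \<le> 1" for x
    using norm_hdual_le_unit[OF j_closed[OF y(1)] that] y(2) by linarith
  have j\<sigma>1: "norm (j \<sigma> x) \<le> 1" if "x \<in> carrier X" "hnorm X x \<le> 1" for x
  proof -
    have "norm (h * j y x) \<le> M * 1"
      using norm_mult_ineq[of h "j y x"] mult_mono[OF nh jy1[OF that]] M by simp
    then show ?thesis using that M by (simp add: j\<sigma>)
  qed
  then have \<sigma>1: "jnorm \<sigma> \<le> 1" by (rule hdual_norm_le)
  have "norm (j \<sigma> x) \<le> r" if x: "x \<in> carrier X" "hnorm X x \<le> 1" for x
  proof -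
    define q where "q = j \<sigma> x"
    define Q where "Q = q * star q"
    have Qs: "star Q = Q" by (simp add: Q_def star_mult star_star)
    have q1: "norm q \<le> 1" using j\<sigma>1[OF x] by (simp add: q_def)
    have nQ: "norm Q = (norm q)\<^sup>2" by (simp add: Q_def norm_mult_star)
    then have nQ1: "norm Q \<le> 1" using q1 by (simp add: power_le_one)
    have qQ: "(norm (star q * Q))\<^sup>2 = norm (Q * Q * Q)"
      using norm_star_mult[of "star q * Q"] by (simp add: star_mult star_star Qs Q_def mult.assoc)
    \<comment> \<open>The exponent 6 comes from \<open>norm Q = (norm q)^2\<close> and the cube of
      \<open>Q\<close>.\<close>
    have "(norm q ^ 6) * norm Q \<le> norm (Q * Q * Q) * norm Q"
      using norm_self_adjoint_power4[OF Qs] by (simp add: nQ flip: power_mult power_add)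
    then have q6: "norm q ^ 6 \<le> norm (Q * Q * Q)"
    proof (cases "q = 0")
      case False
      then have "norm Q > 0" unfolding nQ by simp
      then show ?thesis using \<open>norm q ^ 6 * norm Q \<le> _\<close> by (rule mult_right_le_imp_le[rotated])
    qed simp
    define w where "w = x \<triangleleft> (star q * Q)"
    have w: "w \<in> carrier X" using x by (simp add: w_def)
    have "norm (star q * Q) \<le> 1"
      using norm_mult_ineq[of "star q" Q] mult_mono[OF q1 nQ1] by simp
    then have "hnorm X w \<le> 1"
      using hnorm_act[OF x(1), of "star q * Q"] mult_mono[OF x(2)] unfolding w_def
      by (smt (verit) hnorm_nonneg mult_le_one norm_ge_zero x(2))
    then have "norm (\<psi> (d w)) \<le> \<phi>"
      using \<phi>(1)[OF w] mult_left_mono[of "hnorm X w" 1 \<phi>] \<phi>(2) by linarith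
    moreover have "norm (\<psi> \<sigma> * Q - \<psi> (d w)) \<le> 2/5 * M"
      using norm_localised_le[OF \<psi> _ \<sigma> \<sigma>1 x] M by (simp add: w_def Q_def q_def)
    ultimately have up: "norm (\<psi> \<sigma> * Q) \<le> \<phi> + 2/5 * M"
      using norm_triangle_sub[of "\<psi> \<sigma> * Q" "\<psi> (d w)"] by linarith
    \<comment> \<open>\<open>q\<close> has \<open>h\<close> as its left factor, so
      \<open>star q * Q\<close> is dominated by \<open>star h * Q\<close>, whose square is
      controlled by \<open>h * star h * Q\<close>, a multiple of
      \<open>\<psi> \<sigma> * Q\<close>.\<close>
    have "star q = (1/M) *\<^sub>R (star (j y x) * star h)"
      using x by (simp add: q_def j\<sigma> star_scaleR star_mult)
    then have "norm (star q * Q) = (1/M) * norm (star (j y x) * (star h * Q))"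
      using M by (simp add: mult.assoc)
    also have "\<dots> \<le> (1/M) * norm (star h * Q)"
    proof -
      have "norm (star (j y x) * (star h * Q)) \<le> norm (j y x) * norm (star h * Q)"
        using norm_mult_ineq[of "star (j y x)"] by simp
      also have "\<dots> \<le> norm (star h * Q)"
        using jy1[OF x] by (simp add: mult_left_le_one_le)
      finally show ?thesis using M by (simp add: divide_right_mono)
    qed
    finally have "(norm (star q * Q))\<^sup>2 \<le> ((1/M) * norm (star h * Q))\<^sup>2"
      by (intro power_mono) auto
    also have "\<dots> = (1/M)\<^sup>2 * norm (Q * (h * star h * Q))"
      using norm_star_mult[of "star h * Q"]
      by (simp add: power_mult_distrib power_divide star_mult star_star Qs mult.assoc)
    also have "\<dots> \<le> (1/M)\<^sup>2 * norm (h * star h * Q)"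
    proof (rule mult_left_mono)
      show "norm (Q * (h * star h * Q)) \<le> norm (h * star h * Q)"
        using norm_mult_ineq[of Q "h * star h * Q"] nQ1
        by (smt (verit) mult_left_le_one_le norm_ge_zero)
    qed simp
    also have "h * star h * Q = M *\<^sub>R (\<psi> \<sigma> * Q)"
      using M by (simp add: \<psi>\<sigma>)
    also have "(1/M)\<^sup>2 * norm (M *\<^sub>R (\<psi> \<sigma> * Q)) = norm (\<psi> \<sigma> * Q) / M"
      using M by (simp add: power2_eq_square)
    finally have "norm (Q * Q * Q) \<le> norm (\<psi> \<sigma> * Q) / M" unfolding qQ .
    with q6 have "norm q ^ 6 \<le> norm (\<psi> \<sigma> * Q) / M" by (rule order_trans)
    then have "M * norm q ^ 6 \<le> norm (\<psi> \<sigma> * Q)"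
      using M by (simp add: field_simps)
    also note up
    also note r(2)
    finally have "norm q ^ 6 \<le> r ^ 6" using M by simp
    then show ?thesis
      using power_le_imp_le_base[of "norm q" 5 r] r(1) by (simp add: q_def)
  qed
  \<comment> \<open>The bound on \<open>\<psi>\<close> is now used again with \<open>r\<close> in
    place of 1; since \<open>norm (\<psi> \<sigma>)\<close> is \<open>(norm h)^2 / M\<close>, this
    improves the bound on \<open>h\<close>.\<close>
  then have "jnorm \<sigma> \<le> r" by (rule hdual_norm_le)
  then have "norm (\<psi> \<sigma>) \<le> M * r"
    using \<psi>(2)[OF \<sigma>] M by (smt (verit) mult_left_mono)
  then show ?thesis
    using M by (simp add: \<psi>\<sigma> norm_mult_star h_def power2_eq_square field_simps)
qed

text \<open>5/3 = 1/(1 - 2/5) solves \<open>M = \<phi> + 2/5 M\<close>. If the supremum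
  \<open>M\<close> exceeded \<open>5/3 \<phi>\<close>, every value on the unit ball would be at most
  \<open>M sqrt r\<close> for a fixed \<open>r < 1\<close>, contradicting the choice of
  \<open>M\<close>.\<close>

theorem norm_le_of_restriction:
  assumes \<psi>: "module_map Y \<psi>" "\<And>y. y \<in> carrier Y \<Longrightarrow> norm (\<psi> y) \<le> K * jnorm y"
    and \<phi>: "\<And>x. x \<in> carrier X \<Longrightarrow> norm (\<psi> (d x)) \<le> \<phi> * hnorm X x" "\<phi> \<ge> 0"
    and y: "y \<in> carrier Y"
  shows "norm (\<psi> y) \<le> 5/3 * \<phi> * jnorm y"
proof -
  define U where "U = {y \<in> carrier Y. jnorm y \<le> 1}"
  define M where "M = (SUP y\<in>U. norm (\<psi> y))"
  have "norm (\<psi> u) \<le> \<bar>K\<bar>" if "u \<in> U" for u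
  proof -
    have u: "u \<in> carrier Y" "jnorm u \<le> 1" using that by (auto simp: U_def)
    have "norm (\<psi> u) \<le> \<bar>K\<bar> * jnorm u"
      using \<psi>(2)[OF u(1)] by (meson abs_ge_self jnorm_nonneg u(1) mult_right_mono order_trans)
    also have "\<dots> \<le> \<bar>K\<bar>" using u(2) by (simp add: mult_left_le)
    finally show ?thesis .
  qed
  then have bdd: "bdd_above ((\<lambda>y. norm (\<psi> y)) ` U)"
    by (rule bdd_aboveI2)
  have "jnorm (d \<zero>) \<le> 0"
    by (rule hdual_norm_le) (use norm_ip_le[OF zero_closed] in \<open>simp add: j_d zero_closed\<close>)
  then have dU: "d \<zero> \<in> U"
    by (simp add: U_def d_closed zero_closed)
  have unit: "norm (\<psi> u) \<le> M" if "u \<in> carrier Y" "jnorm u \<le> 1" for u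
    unfolding M_def using that by (intro cSUP_upper bdd) (auto simp: U_def)
  have le: "norm (\<psi> u) \<le> M * jnorm u" if "u \<in> carrier Y" for u
    by (rule norm_le_jnorm_of_unit[OF \<psi> unit that])
  have "M \<le> 5/3 * \<phi>"
  proof (rule ccontr)
    assume "\<not> M \<le> 5/3 * \<phi>"
    then have M: "M > 0" "\<phi> + 2/5 * M < M" using \<phi>(2) by auto
    define \<theta> where "\<theta> = (\<phi> + 2/5 * M) / M"
    have \<theta>: "\<theta> \<ge> 0" "\<theta> < 1" using M \<phi>(2) by (auto simp: \<theta>_def)
    define r where "r = root 6 \<theta>"
    have r: "r \<ge> 0" "r < 1" "r ^ 6 = \<theta>"
      using \<theta> by (auto simp: r_def)
    have "norm (\<psi> u) \<le> M * sqrt r" if "u \<in> U" for u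
    proof -
      have "\<phi> + 2/5 * M \<le> M * r ^ 6"
        using M by (simp add: r(3) \<theta>_def)
      then have "(norm (\<psi> u))\<^sup>2 \<le> M\<^sup>2 * r"
        using that M(1) r(1)
        by (intro norm_le_of_restriction_aux[OF \<psi>(1) le _ \<phi>]) (auto simp: U_def)
      also have "\<dots> = (M * sqrt r)\<^sup>2" using r(1) by (simp add: power_mult_distrib)
      finally show ?thesis by (rule power2_le_imp_le) (use M(1) r(1) in simp)
    qed
    then have "(SUP y\<in>U. norm (\<psi> y)) \<le> M * sqrt r"
      using dU by (intro cSUP_least) auto
    then have "M \<le> M * sqrt r" by (fold M_def)
    moreover have "sqrt r < 1" using r by simp
    ultimately show False using M(1) by simp
  qed
  then show ?thesis
    using le[OF y] mult_right_mono[OF _ jnorm_nonneg[OF y]] order_trans by blast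
qed

corollary eq_zero_of_restriction:
  assumes "module_map Y \<psi>" "\<And>y. y \<in> carrier Y \<Longrightarrow> norm (\<psi> y) \<le> K * jnorm y"
    and "\<And>x. x \<in> carrier X \<Longrightarrow> \<psi> (d x) = 0" and "y \<in> carrier Y"
  shows "\<psi> y = 0"
  using norm_le_of_restriction[OF assms(1,2), where \<phi>=0 and y=y] assms(3,4) by simp

end

section \<open>The bidual\<close>

lemma bidual_simps [simp]:
  "carrier (bidual X) = carrier (dual (hdual X) (hdual_norm X))"
  "madd (bidual X) = madd (dual (hdual X) (hdual_norm X))"
  "mscale (bidual X) = mscale (dual (hdual X) (hdual_norm X))"
  "mact (bidual X) = mact (dual (hdual X) (hdual_norm X))"
  "ip (bidual X) = (\<lambda>F G. F (codot X G))"
  by (simp_all add: bidual_def amodule.extend_def ip_module.fields_def)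

context hilbert_module
begin

lemma module_ops_bidual: "module_ops (bidual X)"
  using module_ops.module_ops_dual[OF module_ops_hdual, of "hdual_norm X"]
  unfolding module_ops_def by simp

sublocale hdual_rep: dual_representation X "hdual X" "\<lambda>f. f" "hat X"
proof (intro dual_representation.intro hilbert_module_axioms module_ops_hdual
    dual_representation_axioms.intro)
qed (auto simp: dual_ops_apply hat_in_hdual, simp add: hat_def)

lemma hat_add: "\<lbrakk>x \<in> carrier X; y \<in> carrier X\<rbrakk> \<Longrightarrow> hat X (x \<oplus> y) = hat X x \<oplus>\<^bsub>hdual X\<^esub> hat X y"
  by (auto simp: hat_def dual_def ip_add_left restrict_def)

lemma hat_scale: "x \<in> carrier X \<Longrightarrow> hat X (c \<cdot> x) = c \<cdot>\<^bsub>hdual X\<^esub> hat X x"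
  by (auto simp: hat_def dual_def ip_scale_left restrict_def)

lemma hat_act: "x \<in> carrier X \<Longrightarrow> hat X (x \<triangleleft> a) = hat X x \<triangleleft>\<^bsub>hdual X\<^esub> a"
  by (auto simp: hat_def dual_def ip_act_left restrict_def)

lemma bidual_bounded:
  assumes "F \<in> carrier (bidual X)"
  shows "\<exists>K\<ge>0. \<forall>f\<in>carrier (hdual X). norm (F f) \<le> K * hdual_norm X f"
proof -
  obtain K where K: "\<forall>f\<in>carrier (hdual X). norm (F f) \<le> K * hdual_norm X f"
    using dual_carrierD(3)[of F "hdual X" "hdual_norm X"] assms by auto
  have "norm (F f) \<le> \<bar>K\<bar> * hdual_norm X f" if "f \<in> carrier (hdual X)" for f
    using bspec[OF K that] mult_right_mono[OF abs_ge_self[of K] hdual_norm_nonneg[OF that]]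
    by linarith
  then show ?thesis by (intro exI[of _ "\<bar>K\<bar>"]) simp
qed

lemma bidual_module_map: "F \<in> carrier (bidual X) \<Longrightarrow> module_map (hdual X) F"
  using dual_carrierD(2)[of F "hdual X"] by simp

lemma codot_in_hdual:
  assumes F: "F \<in> carrier (bidual X)"
  shows "codot X F \<in> carrier (hdual X)"
proof -
  obtain K where K0: "K \<ge> 0" and K: "\<forall>f\<in>carrier (hdual X). norm (F f) \<le> K * hdual_norm X f"
    using bidual_bounded[OF F] by blast
  note F' = module_mapD[OF bidual_module_map[OF F]]
  show ?thesis
  proof (rule dual_carrierI[where K=K])
    show "module_map X (codot X F)"
      by (simp add: module_map_def codot_def hat_add hat_scale hat_act hat_in_hdual F')
    show "norm (codot X F x) \<le> K * hnorm X x" if "x \<in> carrier X" for x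
      using bspec[OF K hat_in_hdual[OF that]] mult_left_mono[OF hdual_norm_hat_le[OF that] K0] that
      by (simp add: codot_def)
  qed (simp add: codot_def)
qed

lemma bidot_in_bidual: "x \<in> carrier X \<Longrightarrow> bidot X x \<in> carrier (bidual X)"
proof -
  assume x: "x \<in> carrier X"
  interpret D: module_ops "hdual X" by (rule module_ops_hdual)
  have "bidot X x \<in> carrier (dual (hdual X) (hdual_norm X))"
  proof (rule dual_carrierI[where K="hnorm X x"])
    show "module_map (hdual X) (bidot X x)"
      using x by (simp add: module_map_def bidot_def dual_ops_apply star_add star_scaleC star_mult
          star_star)
    show "norm (bidot X x f) \<le> hnorm X x * hdual_norm X f" if "f \<in> carrier (hdual X)" for f
      using norm_hdual_le[OF that x] that by (simp add: bidot_def mult.commute)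
  qed (simp add: bidot_def)
  then show ?thesis by simp
qed

text \<open>Here \<open>jnorm F\<close> is the operator norm of the restriction of \<open>F\<close>
  to the copy of \<open>X\<close> in the dual.\<close>

sublocale bidual_rep: dual_representation X "bidual X" "codot X" "bidot X"
proof (intro dual_representation.intro hilbert_module_axioms module_ops_bidual
    dual_representation_axioms.intro)
  show "codot X (bidot X w) x = \<langle>w, x\<rangle>" if "w \<in> carrier X" "x \<in> carrier X" for w x
    using that hat_in_hdual[of x] by (simp add: codot_def bidot_def) (simp add: hat_def ip_star)
  show "codot X y \<in> carrier (hdual X)" if "y \<in> carrier (bidual X)" for y
    by (rule codot_in_hdual[OF that])
  show "bidot X x \<in> carrier (bidual X)" if "x \<in> carrier X" for x
    by (rule bidot_in_bidual[OF that])
qed (simp_all add: codot_def dual_ops_apply hat_in_hdual)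

text \<open>\<open>codot X F\<close> is \<open>F\<close> restricted along \<open>hat X\<close>, so
  this is the restriction estimate for functionals on the dual.\<close>

lemma norm_bidual_le_codot:
  assumes F: "F \<in> carrier (bidual X)" and f: "f \<in> carrier (hdual X)"
  shows "norm (F f) \<le> 5/3 * hdual_norm X (codot X F) * hdual_norm X f"
proof -
  obtain K where K0: "K \<ge> 0" and K: "\<forall>f\<in>carrier (hdual X). norm (F f) \<le> K * hdual_norm X f"
    using bidual_bounded[OF F] by blast
  show ?thesis
  proof (rule hdual_rep.norm_le_of_restriction[OF bidual_module_map[OF F] bspec[OF K] _ _ f])
    show "norm (F (hat X x)) \<le> hdual_norm X (codot X F) * hnorm X x" if "x \<in> carrier X" for x
      using norm_hdual_le[OF codot_in_hdual[OF F] that] that by (simp add: codot_def)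
    show "0 \<le> hdual_norm X (codot X F)"
      by (rule hdual_norm_nonneg[OF codot_in_hdual[OF F]])
  qed
qed

lemma hnorm_bidual_square: "(hnorm (bidual X) F)\<^sup>2 = norm (F (codot X F))"
  by (simp add: hnorm_def)

lemma hnorm_bidual_nonneg [simp]: "hnorm (bidual X) F \<ge> 0"
  by (simp add: hnorm_def)

text \<open>The easy comparison, from evaluating \<open>F\<close> at its own restriction; 2 is a
  round number above \<open>sqrt (5/3)\<close>.\<close>

lemma hnorm_bidual_le:
  assumes F: "F \<in> carrier (bidual X)"
  shows "hnorm (bidual X) F \<le> 2 * hdual_norm X (codot X F)"
proof (rule power2_le_imp_le)
  have "(hnorm (bidual X) F)\<^sup>2 \<le> 5/3 * (hdual_norm X (codot X F))\<^sup>2"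
    using norm_bidual_le_codot[OF F codot_in_hdual[OF F]]
    unfolding hnorm_bidual_square power2_eq_square[of "hdual_norm X (codot X F)"]
    by (simp add: mult.assoc)
  then have "(hnorm (bidual X) F)\<^sup>2 \<le> 4 * (hdual_norm X (codot X F))\<^sup>2"
    using zero_le_power2[of "hdual_norm X (codot X F)"] by linarith
  then show "(hnorm (bidual X) F)\<^sup>2 \<le> (2 * hdual_norm X (codot X F))\<^sup>2"
    by (simp add: power_mult_distrib)
  show "0 \<le> 2 * hdual_norm X (codot X F)"
    using hdual_norm_nonneg[OF codot_in_hdual[OF F]] by simp
qed

text \<open>The harder comparison: for \<open>f = codot X F\<close>, the value \<open>F f\<close>
  must not be small. On the copy of \<open>X\<close> the value
  \<open>F (hat X w) = f w = \<phi> Q^2\<close> is explicit, and localising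
  \<open>\<sigma> = f / \<phi>\<close> shows that \<open>F \<sigma> * Q\<close> differs from it by
  at most \<open>2/3 \<phi>\<close>. Letting \<open>norm q\<close> approach 1 yields
  \<open>1 \<le> norm (F f) / \<phi>^2 + 2/3\<close>, and 3 is 1/(1 - 2/3).\<close>

lemma hdual_norm_codot_le:
  assumes F: "F \<in> carrier (bidual X)"
  shows "(hdual_norm X (codot X F))\<^sup>2 \<le> 3 * (hnorm (bidual X) F)\<^sup>2"
proof (cases "hdual_norm X (codot X F) = 0")
  case False
  define f where "f = codot X F"
  have f: "f \<in> carrier (hdual X)" unfolding f_def by (rule codot_in_hdual[OF F])
  define \<phi> where "\<phi> = hdual_norm X f"
  have \<phi>: "\<phi> > 0"
    using False hdual_norm_nonneg[OF f] by (simp add: \<phi>_def f_def)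
  note F' = module_mapD[OF bidual_module_map[OF F]]
  interpret D: module_ops "hdual X" by (rule module_ops_hdual)
  define m where "m = 1/\<phi>"
  define \<sigma> where "\<sigma> = complex_of_real m \<cdot>\<^bsub>hdual X\<^esub> f"
  have \<sigma>: "\<sigma> \<in> carrier (hdual X)" using f by (simp add: \<sigma>_def)
  have \<sigma>_apply: "\<sigma> x = m *\<^sub>R f x" if "x \<in> carrier X" for x
    using that by (simp add: \<sigma>_def dual_ops_apply scaleC_of_real)
  have F\<sigma>: "F \<sigma> = m *\<^sub>R F f"
    using f by (simp add: \<sigma>_def F' scaleC_of_real)
  have \<sigma>_unit: "norm (\<sigma> x) \<le> 1" if "x \<in> carrier X" "hnorm X x \<le> 1" for x
    using norm_hdual_le_unit[OF f that] that \<phi> by (simp add: \<sigma>_apply m_def \<phi>_def)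
  then have \<sigma>1: "hdual_norm X \<sigma> \<le> 1" by (rule hdual_norm_le)
  define s where "s = norm (F f) / \<phi>\<^sup>2 + 2/3"
  have s: "s \<ge> 0" by (simp add: s_def add_nonneg_nonneg)
  have "norm (f x) \<le> \<phi> * root 4 s" if x: "x \<in> carrier X" "hnorm X x \<le> 1" for x
  proof -
    define q where "q = \<sigma> x"
    define Q where "Q = q * star q"
    have Qs: "star Q = Q" by (simp add: Q_def star_mult star_star)
    have nQ: "norm Q = (norm q)\<^sup>2" by (simp add: Q_def norm_mult_star)
    then have nQ1: "norm Q \<le> 1" using \<sigma>_unit[OF x] by (simp add: q_def power_le_one)
    have fx: "f x = \<phi> *\<^sub>R q" using x \<phi> by (simp add: q_def \<sigma>_apply m_def)
    define w where "w = x \<triangleleft> (star q * Q)"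
    have w: "w \<in> carrier X" using x by (simp add: w_def)
    have "F (hat X w) = f w" using w by (simp add: f_def codot_def)
    also have "\<dots> = \<phi> *\<^sub>R (Q * Q)"
      using module_mapD(3)[OF dual_carrierD(2)[OF f] x(1)] by (simp add: w_def fx Q_def mult.assoc)
    finally have Fw: "F (hat X w) = \<phi> *\<^sub>R (Q * Q)" .
    \<comment> \<open>\<open>5/3 \<phi>\<close> bounds \<open>F\<close> on the unit ball of the
      dual, as its restriction has norm \<open>\<phi>\<close>.\<close>
    have "norm (F \<sigma> * Q - F (hat X w)) \<le> 2/5 * (5/3 * \<phi>)"
      unfolding w_def Q_def q_def
    proof (rule hdual_rep.norm_localised_le[OF bidual_module_map[OF F] _ _ \<sigma> \<sigma>1 x])
      show "norm (F g) \<le> 5/3 * \<phi> * hdual_norm X g" if "g \<in> carrier (hdual X)" for g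
        using norm_bidual_le_codot[OF F that] by (simp add: \<phi>_def f_def)
    qed (use \<phi> in simp)
    then have "\<phi> * norm (Q * Q) \<le> norm (F \<sigma> * Q) + 2/3 * \<phi>"
      using norm_triangle_sub[of "F (hat X w)" "F \<sigma> * Q"] \<phi>
      by (simp add: Fw norm_minus_commute)
    also have "norm (F \<sigma> * Q) \<le> norm (F \<sigma>) * 1"
      using norm_mult_ineq[of "F \<sigma>" Q] mult_left_mono[OF nQ1 norm_ge_zero[of "F \<sigma>"]] by linarith
    also have "norm (F \<sigma>) = norm (F f) / \<phi>"
      using \<phi> by (simp add: F\<sigma> m_def)
    finally have "norm (Q * Q) \<le> s"
      using \<phi> by (simp add: s_def power2_eq_square field_simps)
    moreover have "norm (Q * Q) = norm q ^ 4"
      using norm_star_mult[of Q] by (simp add: Qs nQ flip: power_mult)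
    ultimately have "norm q ^ 4 \<le> (root 4 s) ^ 4"
      using s by simp
    then have "norm q \<le> root 4 s"
      using power_le_imp_le_base[of "norm q" 3 "root 4 s"] s by simp
    then show ?thesis using \<phi> by (simp add: fx)
  qed
  then have "\<phi> \<le> \<phi> * root 4 s"
    unfolding \<phi>_def by (rule hdual_norm_le)
  then have "s \<ge> 1" using \<phi> by simp
  then have "\<phi>\<^sup>2 \<le> 3 * norm (F f)"
    using \<phi> by (simp add: s_def field_simps)
  then show ?thesis by (simp add: \<phi>_def f_def hnorm_bidual_square)
qed simp

text \<open>5/3 times \<open>sqrt 3\<close> is below 3. The extended form is estimated through this
  bound in each variable.\<close>

lemma norm_bidual_le:
  assumes F: "F \<in> carrier (bidual X)" and f: "f \<in> carrier (hdual X)"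
  shows "norm (F f) \<le> 3 * hnorm (bidual X) F * hdual_norm X f"
proof -
  have "5/3 * hdual_norm X (codot X F) \<le> 3 * hnorm (bidual X) F"
  proof (rule power2_le_imp_le)
    have "25 * (hdual_norm X (codot X F))\<^sup>2 \<le> 81 * (hnorm (bidual X) F)\<^sup>2"
      using hdual_norm_codot_le[OF F] zero_le_power2[of "hnorm (bidual X) F"] by linarith
    then show "(5/3 * hdual_norm X (codot X F))\<^sup>2 \<le> (3 * hnorm (bidual X) F)\<^sup>2"
      by (simp add: power_mult_distrib power_divide)
  qed simp
  then have "5/3 * hdual_norm X (codot X F) * hdual_norm X f
      \<le> 3 * hnorm (bidual X) F * hdual_norm X f"
    by (rule mult_right_mono[OF _ hdual_norm_nonneg[OF f]])
  with norm_bidual_le_codot[OF F f] show ?thesis by linarith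
qed

text \<open>The restriction estimate expects a bound by \<open>jnorm\<close>; the bound by the inner
  product norm is converted into one.\<close>

lemma bidual_functional_eq_0:
  assumes \<psi>: "module_map (bidual X) \<psi>"
    and bound: "\<And>F. F \<in> carrier (bidual X) \<Longrightarrow> norm (\<psi> F) \<le> K * hnorm (bidual X) F"
    and zero: "\<And>x. x \<in> carrier X \<Longrightarrow> \<psi> (bidot X x) = 0"
    and F: "F \<in> carrier (bidual X)"
  shows "\<psi> F = 0"
proof (rule bidual_rep.eq_zero_of_restriction[OF \<psi> _ zero F])
  fix G assume G: "G \<in> carrier (bidual X)"
  have "norm (\<psi> G) \<le> \<bar>K\<bar> * hnorm (bidual X) G"
    using bound[OF G] by (meson abs_ge_self hnorm_bidual_nonneg mult_right_mono order_trans)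
  also have "\<dots> \<le> \<bar>K\<bar> * (2 * hdual_norm X (codot X G))"
    by (intro mult_left_mono hnorm_bidual_le G) simp
  finally show "norm (\<psi> G) \<le> (\<bar>K\<bar> * 2) * hdual_norm X (codot X G)" by simp
qed

end

section \<open>Extension of sesquilinear forms\<close>

text \<open>The dual carries conjugated operations, so \<open>x \<mapsto> form_slice Z B x\<close>
  is A-linear although \<open>B\<close> is conjugate-linear in \<open>x\<close>; hence its
  composition with an element of the bidual is a functional on \<open>X\<close>.\<close>

definition form_slice :: "('a::cstar_algebra, 'z) ip_module \<Rightarrow> ('x \<times> 'z \<Rightarrow> 'a) \<Rightarrow> 'x \<Rightarrow> 'z \<Rightarrow> 'a"
  where "form_slice Z B x = (\<lambda>z\<in>carrier Z. B (x, z))"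

text \<open>As a function of \<open>G\<close> this extends
  \<open>z \<mapsto> star (B (_, z))\<close> from \<open>Z\<close> to its bidual, with values in the
  dual of \<open>X\<close>.\<close>

definition form_adjoint ::
    "('a::cstar_algebra, 'x) ip_module \<Rightarrow> ('a, 'z) ip_module \<Rightarrow> ('x \<times> 'z \<Rightarrow> 'a)
      \<Rightarrow> (('z \<Rightarrow> 'a) \<Rightarrow> 'a) \<Rightarrow> 'x \<Rightarrow> 'a"
  where "form_adjoint X Z B G = (\<lambda>x\<in>carrier X. G (form_slice Z B x))"

definition bidual_form ::
    "('a::cstar_algebra, 'x) ip_module \<Rightarrow> ('a, 'z) ip_module \<Rightarrow> ('x \<times> 'z \<Rightarrow> 'a)
      \<Rightarrow> (('x \<Rightarrow> 'a) \<Rightarrow> 'a) \<times> (('z \<Rightarrow> 'a) \<Rightarrow> 'a) \<Rightarrow> 'a"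
  where "bidual_form X Z B =
    (\<lambda>p\<in>carrier (bidual X) \<times> carrier (bidual Z). fst p (form_adjoint X Z B (snd p)))"

lemma bounded_sesquilinear_formD:
  assumes "bounded_sesquilinear_form X Z B"
  shows "B \<in> extensional (carrier X \<times> carrier Z)"
    and "\<lbrakk>x \<in> carrier X; y \<in> carrier X; z \<in> carrier Z\<rbrakk> \<Longrightarrow> B (x \<oplus>\<^bsub>X\<^esub> y, z) = B (x, z) + B (y, z)"
    and "\<lbrakk>x \<in> carrier X; z \<in> carrier Z\<rbrakk> \<Longrightarrow> B (c \<cdot>\<^bsub>X\<^esub> x, z) = scaleC (cnj c) (B (x, z))"
    and "\<lbrakk>x \<in> carrier X; z \<in> carrier Z\<rbrakk> \<Longrightarrow> B (x \<triangleleft>\<^bsub>X\<^esub> a, z) = star a * B (x, z)"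
    and "\<lbrakk>x \<in> carrier X; u \<in> carrier Z; z \<in> carrier Z\<rbrakk> \<Longrightarrow> B (x, u \<oplus>\<^bsub>Z\<^esub> z) = B (x, u) + B (x, z)"
    and "\<lbrakk>x \<in> carrier X; z \<in> carrier Z\<rbrakk> \<Longrightarrow> B (x, c \<cdot>\<^bsub>Z\<^esub> z) = scaleC c (B (x, z))"
    and "\<lbrakk>x \<in> carrier X; z \<in> carrier Z\<rbrakk> \<Longrightarrow> B (x, z \<triangleleft>\<^bsub>Z\<^esub> a) = B (x, z) * a"
  using assms by (auto simp: bounded_sesquilinear_form_def)

lemma bounded_sesquilinear_form_bound:
  assumes "bounded_sesquilinear_form X Z B"
  shows "\<exists>K\<ge>0. \<forall>x\<in>carrier X. \<forall>z\<in>carrier Z. norm (B (x, z)) \<le> K * hnorm X x * hnorm Z z"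
proof -
  have "\<exists>K. \<forall>x\<in>carrier X. \<forall>z\<in>carrier Z. norm (B (x, z)) \<le> K * hnorm X x * hnorm Z z"
    using assms unfolding bounded_sesquilinear_form_def by (elim conjE)
  then obtain K where K:
    "\<forall>x\<in>carrier X. \<forall>z\<in>carrier Z. norm (B (x, z)) \<le> K * hnorm X x * hnorm Z z" ..
  have "norm (B (x, z)) \<le> \<bar>K\<bar> * hnorm X x * hnorm Z z" if "x \<in> carrier X" "z \<in> carrier Z" for x z
  proof -
    have "K * (hnorm X x * hnorm Z z) \<le> \<bar>K\<bar> * (hnorm X x * hnorm Z z)"
      by (intro mult_right_mono) (auto simp: hnorm_def)
    with bspec[OF bspec[OF K that(1)] that(2)] show ?thesis by (simp add: mult.assoc)
  qed
  then show ?thesis by (intro exI[of _ "\<bar>K\<bar>"]) simp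
qed

locale sesquilinear_form = X: hilbert_module X + Z: hilbert_module Z
  for X :: "('a::cstar_algebra, 'x) ip_module"
    and Z :: "('a, 'z) ip_module" +
  fixes B :: "'x \<times> 'z \<Rightarrow> 'a"
  assumes form: "bounded_sesquilinear_form X Z B"
begin

lemmas formD = bounded_sesquilinear_formD[OF form]

lemma form_slice_in_hdual:
  assumes x: "x \<in> carrier X"
  shows "form_slice Z B x \<in> carrier (hdual Z)"
proof -
  obtain K where K: "\<forall>x\<in>carrier X. \<forall>z\<in>carrier Z. norm (B (x, z)) \<le> K * hnorm X x * hnorm Z z"
    using bounded_sesquilinear_form_bound[OF form] by blast
  show ?thesis
  proof (rule dual_carrierI[where K="K * hnorm X x"])
    show "module_map Z (form_slice Z B x)"
      using x by (simp add: module_map_def form_slice_def formD)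
  qed (use x K in \<open>auto simp: form_slice_def\<close>)
qed

lemma form_slice_add:
  "\<lbrakk>x \<in> carrier X; y \<in> carrier X\<rbrakk> \<Longrightarrow>
    form_slice Z B (x \<oplus>\<^bsub>X\<^esub> y) = form_slice Z B x \<oplus>\<^bsub>hdual Z\<^esub> form_slice Z B y"
  by (auto simp: form_slice_def dual_def formD restrict_def)

lemma form_slice_scale:
  "x \<in> carrier X \<Longrightarrow> form_slice Z B (c \<cdot>\<^bsub>X\<^esub> x) = c \<cdot>\<^bsub>hdual Z\<^esub> form_slice Z B x"
  by (auto simp: form_slice_def dual_def formD restrict_def)

lemma form_slice_act:
  "x \<in> carrier X \<Longrightarrow> form_slice Z B (x \<triangleleft>\<^bsub>X\<^esub> a) = form_slice Z B x \<triangleleft>\<^bsub>hdual Z\<^esub> a"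
  by (auto simp: form_slice_def dual_def formD restrict_def)

text \<open>The bound is wanted in terms of \<open>hnorm (bidual Z) G\<close>, while evaluating
  \<open>G\<close> at a slice involves its operator norm; the factor 3 is the price of the
  comparison.\<close>

lemma form_adjoint_bounded:
  "\<exists>K\<ge>0. \<forall>G\<in>carrier (bidual Z). \<forall>x\<in>carrier X.
    norm (form_adjoint X Z B G x) \<le> (K * hnorm (bidual Z) G) * hnorm X x"
proof -
  obtain K where K: "K \<ge> 0"
    "\<forall>x\<in>carrier X. \<forall>z\<in>carrier Z. norm (B (x, z)) \<le> K * hnorm X x * hnorm Z z"
    using bounded_sesquilinear_form_bound[OF form] by blast
  have "norm (form_adjoint X Z B G x) \<le> (3 * K * hnorm (bidual Z) G) * hnorm X x"
    if G: "G \<in> carrier (bidual Z)" and x: "x \<in> carrier X" for G x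
  proof -
    have "hdual_norm Z (form_slice Z B x) \<le> K * hnorm X x"
    proof (rule Z.hdual_norm_le)
      fix z assume z: "z \<in> carrier Z" "hnorm Z z \<le> 1"
      have "norm (B (x, z)) \<le> (K * hnorm X x) * 1"
        using bspec[OF bspec[OF K(2) x] z(1)] mult_left_mono[OF z(2), of "K * hnorm X x"] K(1) by simp
      then show "norm (form_slice Z B x z) \<le> K * hnorm X x" using z by (simp add: form_slice_def)
    qed
    then have "3 * hnorm (bidual Z) G * hdual_norm Z (form_slice Z B x)
        \<le> 3 * hnorm (bidual Z) G * (K * hnorm X x)"
      by (intro mult_left_mono) auto
    then show ?thesis
      using Z.norm_bidual_le[OF G form_slice_in_hdual[OF x]] x
      by (simp add: form_adjoint_def mult_ac)
  qed
  then show ?thesis using K(1) by (intro exI[of _ "3 * K"] conjI ballI) simp_all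
qed

lemma form_adjoint_in_hdual:
  assumes G: "G \<in> carrier (bidual Z)"
  shows "form_adjoint X Z B G \<in> carrier (hdual X)"
proof -
  obtain K where K: "\<forall>G\<in>carrier (bidual Z). \<forall>x\<in>carrier X.
      norm (form_adjoint X Z B G x) \<le> (K * hnorm (bidual Z) G) * hnorm X x"
    using form_adjoint_bounded by blast
  note G' = module_mapD[OF Z.bidual_module_map[OF G]]
  show ?thesis
  proof (rule dual_carrierI[where K="K * hnorm (bidual Z) G"])
    show "module_map X (form_adjoint X Z B G)"
      by (simp add: module_map_def form_adjoint_def form_slice_add form_slice_scale form_slice_act
          form_slice_in_hdual G')
    show "norm (form_adjoint X Z B G x) \<le> K * hnorm (bidual Z) G * hnorm X x"
      if "x \<in> carrier X" for x by (rule bspec[OF bspec[OF K G] that])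
  qed (simp add: form_adjoint_def)
qed

lemma form_adjoint_add:
  "form_adjoint X Z B (G \<oplus>\<^bsub>bidual Z\<^esub> H) = form_adjoint X Z B G \<oplus>\<^bsub>hdual X\<^esub> form_adjoint X Z B H"
  by (rule ext) (simp add: form_adjoint_def dual_ops_apply form_slice_in_hdual,
      simp add: dual_def restrict_def)

lemma form_adjoint_scale:
  "form_adjoint X Z B (c \<cdot>\<^bsub>bidual Z\<^esub> G) = c \<cdot>\<^bsub>hdual X\<^esub> form_adjoint X Z B G"
  by (rule ext) (simp add: form_adjoint_def dual_ops_apply form_slice_in_hdual,
      simp add: dual_def restrict_def)

lemma form_adjoint_act:
  "form_adjoint X Z B (G \<triangleleft>\<^bsub>bidual Z\<^esub> a) = form_adjoint X Z B G \<triangleleft>\<^bsub>hdual X\<^esub> a"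
  by (rule ext) (simp add: form_adjoint_def dual_ops_apply form_slice_in_hdual,
      simp add: dual_def restrict_def)

lemma bidual_form_apply:
  "\<lbrakk>F \<in> carrier (bidual X); G \<in> carrier (bidual Z)\<rbrakk> \<Longrightarrow>
    bidual_form X Z B (F, G) = F (form_adjoint X Z B G)"
  by (simp add: bidual_form_def)

lemma bounded_sesquilinear_bidual_form:
  "bounded_sesquilinear_form (bidual X) (bidual Z) (bidual_form X Z B)"
proof -
  interpret XX: module_ops "bidual X" by (rule X.module_ops_bidual)
  interpret ZZ: module_ops "bidual Z" by (rule Z.module_ops_bidual)
  note F' = module_mapD[OF X.bidual_module_map]
  note adj = form_adjoint_in_hdual
  have left: "(F \<oplus>\<^bsub>bidual X\<^esub> H) f = F f + H f" "(c \<cdot>\<^bsub>bidual X\<^esub> F) f = scaleC (cnj c) (F f)"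
    "(F \<triangleleft>\<^bsub>bidual X\<^esub> a) f = star a * F f" if "f \<in> carrier (hdual X)" for F H f c a
    using that by (simp_all add: dual_ops_apply)
  obtain K where K: "K \<ge> 0" "\<forall>G\<in>carrier (bidual Z). \<forall>x\<in>carrier X.
      norm (form_adjoint X Z B G x) \<le> (K * hnorm (bidual Z) G) * hnorm X x"
    using form_adjoint_bounded by blast
  have bound: "norm (bidual_form X Z B (F, G)) \<le> (3 * K) * hnorm (bidual X) F * hnorm (bidual Z) G"
    if F: "F \<in> carrier (bidual X)" and G: "G \<in> carrier (bidual Z)" for F G
  proof -
    have "hdual_norm X (form_adjoint X Z B G) \<le> K * hnorm (bidual Z) G"
    proof (rule X.hdual_norm_le)
      fix x assume x: "x \<in> carrier X" "hnorm X x \<le> 1"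
      have "(K * hnorm (bidual Z) G) * hnorm X x \<le> (K * hnorm (bidual Z) G) * 1"
        using K(1) x(2) by (intro mult_left_mono) auto
      with bspec[OF bspec[OF K(2) G] x(1)] show "norm (form_adjoint X Z B G x) \<le> K * hnorm (bidual Z) G"
        by linarith
    qed
    then have "3 * hnorm (bidual X) F * hdual_norm X (form_adjoint X Z B G)
        \<le> 3 * hnorm (bidual X) F * (K * hnorm (bidual Z) G)"
      by (intro mult_left_mono) auto
    with X.norm_bidual_le[OF F adj[OF G]] show ?thesis
      by (simp add: bidual_form_apply[OF F G] mult_ac)
  qed
  show ?thesis
    unfolding bounded_sesquilinear_form_def
  proof (intro conjI ballI allI)
    show "bidual_form X Z B \<in> extensional (carrier (bidual X) \<times> carrier (bidual Z))"
      by (simp add: bidual_form_def del: bidual_simps)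
    show "\<exists>K. \<forall>F\<in>carrier (bidual X). \<forall>G\<in>carrier (bidual Z).
        norm (bidual_form X Z B (F, G)) \<le> K * hnorm (bidual X) F * hnorm (bidual Z) G"
      using bound by blast
  qed (simp_all add: bidual_form_apply left adj F' form_adjoint_add form_adjoint_scale
      form_adjoint_act del: bidual_simps)
qed

lemma bidual_form_extends:
  assumes x: "x \<in> carrier X" and z: "z \<in> carrier Z"
  shows "bidual_form X Z B (bidot X x, bidot Z z) = B (x, z)"
proof -
  have "bidual_form X Z B (bidot X x, bidot Z z) = bidot X x (form_adjoint X Z B (bidot Z z))"
    by (rule bidual_form_apply[OF X.bidot_in_bidual[OF x] Z.bidot_in_bidual[OF z]])
  also have "\<dots> = star (bidot Z z (form_slice Z B x))"
    using x form_adjoint_in_hdual[OF Z.bidot_in_bidual[OF z]]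
    by (simp add: bidot_def[of X]) (simp add: form_adjoint_def)
  also have "\<dots> = B (x, z)"
    using form_slice_in_hdual[OF x] z by (simp add: bidot_def star_star) (simp add: form_slice_def)
  finally show ?thesis .
qed

end

text \<open>One variable at a time: for \<open>x\<close> in \<open>X\<close> the difference of the
  forms is a functional of \<open>G\<close> vanishing on the copy of \<open>Z\<close>; then, for
  fixed \<open>G\<close>, the \<open>star\<close> of the difference is a functional of
  \<open>F\<close> vanishing on the copy of \<open>X\<close>.\<close>

lemma bidual_form_unique:
  fixes X :: "('a::cstar_algebra, 'x) ip_module" and Z :: "('a, 'z) ip_module"
  assumes X: "hilbert_module X" and Z: "hilbert_module Z"
    and B: "bounded_sesquilinear_form (bidual X) (bidual Z) B"
    and C: "bounded_sesquilinear_form (bidual X) (bidual Z) C"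
    and eq: "\<And>x z. \<lbrakk>x \<in> carrier X; z \<in> carrier Z\<rbrakk> \<Longrightarrow> B (bidot X x, bidot Z z) = C (bidot X x, bidot Z z)"
  shows "B = C"
proof -
  interpret X: hilbert_module X by (rule X)
  interpret Z: hilbert_module Z by (rule Z)
  note B' = bounded_sesquilinear_formD[OF B] and C' = bounded_sesquilinear_formD[OF C]
  obtain K where K: "\<forall>F\<in>carrier (bidual X). \<forall>G\<in>carrier (bidual Z).
      norm (B (F, G)) \<le> K * hnorm (bidual X) F * hnorm (bidual Z) G"
    using bounded_sesquilinear_form_bound[OF B] by blast
  obtain L where L: "\<forall>F\<in>carrier (bidual X). \<forall>G\<in>carrier (bidual Z).
      norm (C (F, G)) \<le> L * hnorm (bidual X) F * hnorm (bidual Z) G"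
    using bounded_sesquilinear_form_bound[OF C] by blast
  define D where "D F G = B (F, G) - C (F, G)" for F G
  have bound: "norm (D F G) \<le> (K + L) * hnorm (bidual X) F * hnorm (bidual Z) G"
    if "F \<in> carrier (bidual X)" "G \<in> carrier (bidual Z)" for F G
    using bspec[OF bspec[OF K that(1)] that(2)] bspec[OF bspec[OF L that(1)] that(2)]
      norm_triangle_ineq4[of "B (F, G)" "C (F, G)"]
    by (simp add: D_def algebra_simps)
  have right: "module_map (bidual Z) (D F)" if "F \<in> carrier (bidual X)" for F
    using that unfolding module_map_def D_def
    by (simp add: B' C' scaleC_diff_right left_diff_distrib del: bidual_simps)
  have left: "module_map (bidual X) (\<lambda>F. star (D F G))" if "G \<in> carrier (bidual Z)" for G
    using that unfolding module_map_def D_def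
    by (simp add: B' C' star_diff star_add star_scaleC star_mult star_star scaleC_diff_right
        left_diff_distrib del: bidual_simps)
  have D_dot: "D (bidot X x) G = 0" if x: "x \<in> carrier X" and G: "G \<in> carrier (bidual Z)" for x G
  proof (rule Z.bidual_functional_eq_0[OF right[OF X.bidot_in_bidual[OF x]] _ _ G])
    show "norm (D (bidot X x) G) \<le> ((K + L) * hnorm (bidual X) (bidot X x)) * hnorm (bidual Z) G"
      if "G \<in> carrier (bidual Z)" for G
      by (rule bound[OF X.bidot_in_bidual[OF x] that])
    show "D (bidot X x) (bidot Z z) = 0" if "z \<in> carrier Z" for z
      using eq[OF x that] by (simp add: D_def)
  qed
  have D_0: "D F G = 0" if F: "F \<in> carrier (bidual X)" and G: "G \<in> carrier (bidual Z)" for F G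
  proof -
    have "star (D F G) = 0"
    proof (rule X.bidual_functional_eq_0[OF left[OF G] _ _ F])
      show "norm (star (D F G)) \<le> ((K + L) * hnorm (bidual Z) G) * hnorm (bidual X) F"
        if "F \<in> carrier (bidual X)" for F
        using bound[OF that G] by (simp add: mult_ac)
      show "star (D (bidot X x) G) = 0" if "x \<in> carrier X" for x
        using D_dot[OF that G] by simp
    qed
    then show ?thesis by (metis star_star star_zero)
  qed
  show ?thesis
  proof (rule extensionalityI[OF B'(1) C'(1)])
    fix p assume "p \<in> carrier (bidual X) \<times> carrier (bidual Z)"
    then show "B p = C p" using D_0[of "fst p" "snd p"] by (auto simp: D_def)
  qed
qed

theorem proposition3p11:
  fixes X :: "('a::cstar_algebra, 'x) ip_module"
    and Z :: "('a, 'z) ip_module"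
    and B :: "'x \<times> 'z \<Rightarrow> 'a"
  assumes "hilbert_module X"
    and "hilbert_module Z"
    and "bounded_sesquilinear_form X Z B"
  shows "\<exists>!B'. bounded_sesquilinear_form (bidual X) (bidual Z) B' \<and>
    (\<forall>x\<in>carrier X. \<forall>z\<in>carrier Z. B' (bidot X x, bidot Z z) = B (x, z))"
proof -
  interpret sesquilinear_form X Z B
    using assms by (simp add: sesquilinear_form_def sesquilinear_form_axioms_def)
  show ?thesis
  proof (rule ex1I[of _ "bidual_form X Z B"])
    show "bounded_sesquilinear_form (bidual X) (bidual Z) (bidual_form X Z B) \<and>
        (\<forall>x\<in>carrier X. \<forall>z\<in>carrier Z. bidual_form X Z B (bidot X x, bidot Z z) = B (x, z))"
      using bounded_sesquilinear_bidual_form bidual_form_extends by blast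
    fix C assume "bounded_sesquilinear_form (bidual X) (bidual Z) C \<and>
        (\<forall>x\<in>carrier X. \<forall>z\<in>carrier Z. C (bidot X x, bidot Z z) = B (x, z))"
    then show "C = bidual_form X Z B"
      using bidual_form_unique[OF assms(1,2)] bounded_sesquilinear_bidual_form bidual_form_extends
      by metis
  qed
qed

end
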